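(* Let $G_1=\langle a,b,c,t\mid tat^{-1}=a,\ tbt^{-1}=ba,\ tct^{-1}=ca^2\rangle$ be the Gersten group and let $G_2=\langle x,s\mid sxs^{-1}=x\rangle\cong\mathbb{Z}^2$. Then the tubular group $G=G_1\ast_{a=x}G_2$ (the amalgamated product identifying the infinite cyclic subgroups $\langle a\rangle$ and $\langle x\rangle$ via $a=x$) is not virtually free-by-cyclic.
   Context: A group is free-by-cyclic if it admits a surjection onto $\mathbb{Z}$ with free kernel (possibly of infinite rank); it is virtually free-by-cyclic if it has a finite-index subgroup that is free-by-cyclic. A tubular group is a group that splits as a finite graph of groups with all vertex groups isomorphic to $\mathbb{Z}^2$ and all edge groups isomorphic to $\mathbb{Z}$. *)

theory Defs
  imports "HOL-Algebra.Elementary_Groups" "Graph_Theory.Digraph_Component"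
begin

section \<open>Free groups as groups of reduced words\<close>

text \<open>A letter is a generator together with a sign; \<^term>\<open>False\<close> marks the inverse.\<close>

type_synonym 'x word = "('x \<times> bool) list"

abbreviation pos :: "'x \<Rightarrow> 'x \<times> bool" where "pos x \<equiv> (x, True)"
abbreviation neg :: "'x \<Rightarrow> 'x \<times> bool" where "neg x \<equiv> (x, False)"

definition flip :: "'x \<times> bool \<Rightarrow> 'x \<times> bool" where
  "flip p = (fst p, \<not> snd p)"

definition word_inv :: "'x word \<Rightarrow> 'x word" where
  "word_inv w = rev (map flip w)"

definition reduced :: "'x word \<Rightarrow> bool" where
  "reduced w \<longleftrightarrow> successively (\<lambda>p q. q \<noteq> flip p) w"

fun push :: "'x \<times> bool \<Rightarrow> 'x word \<Rightarrow> 'x word" where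
  "push p [] = [p]"
| "push p (q # w) = (if q = flip p then w else p # q # w)"

definition reduce :: "'x word \<Rightarrow> 'x word" where
  "reduce w = foldr push w []"

definition free_group :: "'x set \<Rightarrow> 'x word monoid" where
  "free_group X = \<lparr>carrier = {w. reduced w \<and> fst ` set w \<subseteq> X},
                   monoid.mult = (\<lambda>u v. reduce (u @ v)), one = []\<rparr>"

lemma flip_flip [simp]: "flip (flip p) = p"
  by (simp add: flip_def)

lemma flip_neq [simp]: "flip p \<noteq> p" "p \<noteq> flip p"
  by (auto simp: flip_def prod_eq_iff)

lemma fst_flip [simp]: "fst (flip p) = fst p"
  by (simp add: flip_def)

lemma reduced_Nil [simp]: "reduced []"
  by (simp add: reduced_def)

lemma reduced_ConsD: "reduced (p # w) \<Longrightarrow> reduced w"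
  by (cases w) (auto simp: reduced_def)

lemma reduced_push: "reduced w \<Longrightarrow> reduced (push p w)"
  by (cases w) (auto simp: reduced_def successively_Cons)

lemma push_reduced: "reduced (p # w) \<Longrightarrow> push p w = p # w"
  by (cases w) (auto simp: reduced_def)

lemma push_flip: "reduced w \<Longrightarrow> push p (push (flip p) w) = w"
  by (cases w) (auto simp: push_reduced)

lemma reduced_foldr: "reduced v \<Longrightarrow> reduced (foldr push u v)"
  by (induction u) (auto simp: reduced_push)

lemma reduced_reduce [simp]: "reduced (reduce w)"
  by (simp add: reduce_def reduced_foldr)

lemma reduce_id: "reduced w \<Longrightarrow> reduce w = w"
proof (induction w)
  case (Cons p w)
  then show ?case
    using push_reduced[OF Cons.prems] reduced_ConsD[OF Cons.prems] by (simp add: reduce_def)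
qed (simp add: reduce_def)

lemma foldr_push_push:
  assumes "reduced v"
  shows "foldr push (push p u) v = push p (foldr push u v)"
proof (cases "\<exists>u'. u = flip p # u'")
  case True
  then obtain u' where u: "u = flip p # u'" by blast
  then show ?thesis
    using push_flip[OF reduced_foldr[OF assms]] by simp
next
  case False
  then have "push p u = p # u" by (cases u) simp_all
  then show ?thesis by simp
qed

lemma foldr_push_reduce:
  assumes "reduced v"
  shows "foldr push (reduce u) v = foldr push u v"
proof (induction u)
  case (Cons p u)
  then show ?case using foldr_push_push[OF assms, of p "reduce u"] by (simp add: reduce_def)
qed (simp add: reduce_def)

lemma reduce_append: "reduce (u @ v) = foldr push u (reduce v)"
  by (simp add: reduce_def)

lemma reduce_append_left [simp]: "reduce (reduce u @ v) = reduce (u @ v)"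
  by (simp add: reduce_append foldr_push_reduce)

lemma reduce_append_right [simp]: "reduce (u @ reduce v) = reduce (u @ v)"
  by (simp add: reduce_append reduce_id)

lemma set_push: "set (push p w) \<subseteq> insert p (set w)"
  by (cases w) auto

lemma set_reduce: "set (reduce w) \<subseteq> set w"
proof (induction w)
  case (Cons p w)
  then show ?case using set_push[of p "reduce w"] by (auto simp: reduce_def)
qed (simp add: reduce_def)

lemma reduce_word_inv_left: "reduce (word_inv w @ w) = []"
proof (induction w)
  case (Cons p w)
  have "reduce (word_inv (p # w) @ p # w) = foldr push (word_inv w) (push (flip p) (push p (reduce w)))"
    by (simp add: reduce_def word_inv_def)
  also have "push (flip p) (push p (reduce w)) = reduce w"
    using push_flip[of "reduce w" "flip p"] by simp
  finally show ?case using Cons by (simp add: reduce_append)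
qed (simp add: reduce_def word_inv_def)

lemma letters_word_inv [simp]: "fst ` set (word_inv w) = fst ` set w"
  by (simp add: word_inv_def image_image)

lemma letters_reduce: "fst ` set w \<subseteq> X \<Longrightarrow> fst ` set (reduce w) \<subseteq> X"
  using image_mono[OF set_reduce[of w], of fst] by (rule subset_trans)

lemma group_free_group: "group (free_group X)"
proof (rule groupI; unfold free_group_def; simp)
  fix u v w :: "'a word"
  assume u: "reduced u \<and> fst ` set u \<subseteq> X"
  show "reduce u = u" using u by (simp add: reduce_id)
  show "\<exists>v. reduced v \<and> fst ` set v \<subseteq> X \<and> reduce (v @ u) = []"
  proof (intro exI conjI)
    show "fst ` set (reduce (word_inv u)) \<subseteq> X"
      using u by (intro letters_reduce) simp
  qed (simp_all add: reduce_word_inv_left)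
  show "fst ` set (reduce (u @ v)) \<subseteq> X"
    if "reduced v \<and> fst ` set v \<subseteq> X"
    using u that by (intro letters_reduce) (simp add: image_Un)
qed

text \<open>A free basis of a group is a subset of its carrier, so it is enough to
  quantify over sets of elements; the rank may be infinite or zero.\<close>

definition is_free_group :: "('a, 'm) monoid_scheme \<Rightarrow> bool" where
  "is_free_group K \<longleftrightarrow> (\<exists>X :: 'a set. free_group X \<cong> K)"


section \<open>Presentations\<close>

definition normal_closure :: "('a, 'm) monoid_scheme \<Rightarrow> 'a set \<Rightarrow> 'a set" where
  "normal_closure G R = \<Inter>{N. N \<lhd> G \<and> R \<subseteq> N}"

lemma (in group) normal_closure_normal:
  assumes "R \<subseteq> carrier G"
  shows "normal_closure G R \<lhd> G"
proof (rule normal_invI)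
  have ne: "{N. N \<lhd> G \<and> R \<subseteq> N} \<noteq> {}"
    using assms normal_invI[OF subgroup_self] by auto
  show "subgroup (normal_closure G R) G"
    unfolding normal_closure_def
    by (rule subgroups_Inter) (use ne in \<open>auto dest: normal_imp_subgroup\<close>)
  show "p \<otimes> h \<otimes> inv p \<in> normal_closure G R"
    if "p \<in> carrier G" "h \<in> normal_closure G R" for p h
    using that by (auto simp: normal_closure_def dest: normal.inv_op_closed2)
qed

text \<open>A relation \<open>u = v\<close> is given as the pair \<open>(u, v)\<close> of words, which need not be reduced.\<close>

definition relator_closure :: "'x set \<Rightarrow> ('x word \<times> 'x word) set \<Rightarrow> 'x word set" where
  "relator_closure X E = normal_closure (free_group X) ((\<lambda>(u, v). reduce (u @ word_inv v)) ` E)"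

definition presented_group :: "'x set \<Rightarrow> ('x word \<times> 'x word) set \<Rightarrow> 'x word set monoid" where
  "presented_group X E = free_group X Mod relator_closure X E"

definition word_class :: "'x set \<Rightarrow> ('x word \<times> 'x word) set \<Rightarrow> 'x word \<Rightarrow> 'x word set" where
  "word_class X E w = relator_closure X E #>\<^bsub>free_group X\<^esub> reduce w"


lemma group_presented_group:
  assumes "\<And>u v. (u, v) \<in> E \<Longrightarrow> fst ` set u \<subseteq> X \<and> fst ` set v \<subseteq> X"
  shows "group (presented_group X E)"
proof -
  interpret F: group "free_group X" by (rule group_free_group)
  have "reduce (u @ word_inv v) \<in> carrier (free_group X)" if "(u, v) \<in> E" for u v
  proof -
    have "fst ` set (u @ word_inv v) \<subseteq> X"
      using assms[OF that] by (simp add: image_Un)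
    then show ?thesis
      using letters_reduce[of "u @ word_inv v" X] by (simp add: free_group_def)
  qed
  then have "relator_closure X E \<lhd> free_group X"
    unfolding relator_closure_def by (intro F.normal_closure_normal) auto
  then show ?thesis
    unfolding presented_group_def by (rule normal.factorgroup_is_group)
qed


section \<open>Amalgamated products and graphs of groups\<close>

text \<open>The multiplication table of a group whose element \<open>p\<close> is written as the generator \<open>\<iota> p\<close>.\<close>

definition mult_relations :: "('a \<Rightarrow> 'x) \<Rightarrow> ('a, 'm) monoid_scheme \<Rightarrow> ('x word \<times> 'x word) set" where
  "mult_relations \<iota> G =
     {([pos (\<iota> p), pos (\<iota> q)], [pos (\<iota> (p \<otimes>\<^bsub>G\<^esub> q))]) | p q. p \<in> carrier G \<and> q \<in> carrier G}"

text \<open>The amalgamated product of \<open>G\<close> and \<open>H\<close> along \<open>f : C \<rightarrow> G\<close> and \<open>g : C \<rightarrow> H\<close>, i.e. the free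
  product modulo \<open>f c = g c\<close>. The maps are meant to be injective homomorphisms.\<close>

definition amalgamated_product ::
  "('c, 'k) monoid_scheme \<Rightarrow> ('c \<Rightarrow> 'a) \<Rightarrow> ('a, 'm) monoid_scheme \<Rightarrow>
   ('c \<Rightarrow> 'b) \<Rightarrow> ('b, 'n) monoid_scheme \<Rightarrow> ('a + 'b) word set monoid" where
  "amalgamated_product C f G g H =
     presented_group (Inl ` carrier G \<union> Inr ` carrier H)
       (mult_relations Inl G \<union> mult_relations Inr H \<union>
        {([pos (Inl (f c))], [pos (Inr (g c))]) | c. c \<in> carrier C})"

text \<open>Each geometric edge of the underlying graph is represented by one arc (a choice of
  orientation); loops and multiple edges are allowed.\<close>

record ('v, 'e, 'a, 'c) graph_of_groups =
  base :: "('v, 'e) pre_digraph"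
  vertex_group :: "'v \<Rightarrow> 'a monoid"
  edge_group :: "'e \<Rightarrow> 'c monoid"
  tail_map :: "'e \<Rightarrow> 'c \<Rightarrow> 'a"
  head_map :: "'e \<Rightarrow> 'c \<Rightarrow> 'a"

definition is_graph_of_groups :: "('v, 'e, 'a, 'c) graph_of_groups \<Rightarrow> bool" where
  "is_graph_of_groups \<G> \<longleftrightarrow>
     wf_digraph (base \<G>) \<and> connected (base \<G>) \<and>
     (\<forall>v \<in> verts (base \<G>). group (vertex_group \<G> v)) \<and>
     (\<forall>e \<in> arcs (base \<G>). group (edge_group \<G> e) \<and>
        tail_map \<G> e \<in> mon (edge_group \<G> e) (vertex_group \<G> (tail (base \<G>) e)) \<and>
        head_map \<G> e \<in> mon (edge_group \<G> e) (vertex_group \<G> (head (base \<G>) e)))"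

text \<open>\<^const>\<open>Digraph_Component.spanning_tree\<close> only forbids directed cycles, so it is not the
  notion for undirected graphs; a maximal subtree is a minimal connected spanning subgraph.\<close>

definition maximal_subtree :: "('v, 'e) pre_digraph \<Rightarrow> ('v, 'e) pre_digraph \<Rightarrow> bool" where
  "maximal_subtree T \<Gamma> \<longleftrightarrow> spanning T \<Gamma> \<and> connected T \<and>
     (\<forall>e \<in> arcs T. \<not> connected (T\<lparr>arcs := arcs T - {e}\<rparr>))"

text \<open>Bass--Serre: the vertex groups together with a stable letter \<open>e\<close> for every edge, subject to
  \<open>e \<cdot> head_map e c \<cdot> e\<inverse> = tail_map e c\<close> and to \<open>e = 1\<close> for the edges of the maximal subtree.\<close>

definition fundamental_group ::
  "('v, 'e, 'a, 'c) graph_of_groups \<Rightarrow> ('v, 'e) pre_digraph \<Rightarrow> ('v \<times> 'a + 'e) word set monoid" where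
  "fundamental_group \<G> T =
     presented_group
       ({Inl (v, p) | v p. v \<in> verts (base \<G>) \<and> p \<in> carrier (vertex_group \<G> v)} \<union>
        Inr ` arcs (base \<G>))
       ((\<Union>v \<in> verts (base \<G>). mult_relations (\<lambda>p. Inl (v, p)) (vertex_group \<G> v)) \<union>
        {([pos (Inr e), pos (Inl (head (base \<G>) e, head_map \<G> e c)), neg (Inr e)],
          [pos (Inl (tail (base \<G>) e, tail_map \<G> e c))])
          | e c. e \<in> arcs (base \<G>) \<and> c \<in> carrier (edge_group \<G> e)} \<union>
        {([pos (Inr e)], []) | e. e \<in> arcs T})"

text \<open>Fixing the types is no restriction: the graph is finite, and vertex and edge groups may be
  replaced by isomorphic copies.\<close>

definition tubular :: "('a, 'm) monoid_scheme \<Rightarrow> bool" where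
  "tubular G \<longleftrightarrow>
     (\<exists>(\<G> :: (nat, nat, int \<times> int, int) graph_of_groups) T.
        is_graph_of_groups \<G> \<and> fin_digraph (base \<G>) \<and> maximal_subtree T (base \<G>) \<and>
        (\<forall>v \<in> verts (base \<G>). vertex_group \<G> v \<cong> integer_group \<times>\<times> integer_group) \<and>
        (\<forall>e \<in> arcs (base \<G>). edge_group \<G> e \<cong> integer_group) \<and>
        fundamental_group \<G> T \<cong> G)"


section \<open>Free-by-cyclic groups\<close>

definition free_by_cyclic :: "('a, 'm) monoid_scheme \<Rightarrow> bool" where
  "free_by_cyclic G \<longleftrightarrow>
     (\<exists>h \<in> epi G integer_group. is_free_group (G\<lparr>carrier := kernel G integer_group h\<rparr>))"

definition virtually_free_by_cyclic :: "('a, 'm) monoid_scheme \<Rightarrow> bool" where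
  "virtually_free_by_cyclic G \<longleftrightarrow>
     (\<exists>H. subgroup H G \<and> finite (rcosets\<^bsub>G\<^esub> H) \<and> free_by_cyclic (G\<lparr>carrier := H\<rparr>))"


section \<open>The groups of the statement\<close>

datatype gersten_gen = a | b | c | t
datatype torus_gen = x | s

definition gersten_rels :: "(gersten_gen word \<times> gersten_gen word) set" where
  "gersten_rels = {([pos t, pos a, neg t], [pos a]),
                   ([pos t, pos b, neg t], [pos b, pos a]),
                   ([pos t, pos c, neg t], [pos c, pos a, pos a])}"

definition gersten_group :: "gersten_gen word set monoid" where
  "gersten_group = presented_group UNIV gersten_rels"

definition gersten_a :: "gersten_gen word set" where
  "gersten_a = word_class UNIV gersten_rels [pos a]"

definition torus_rels :: "(torus_gen word \<times> torus_gen word) set" where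
  "torus_rels = {([pos s, pos x, neg s], [pos x])}"

definition torus_group :: "torus_gen word set monoid" where
  "torus_group = presented_group UNIV torus_rels"

definition torus_x :: "torus_gen word set" where
  "torus_x = word_class UNIV torus_rels [pos x]"

hide_const (open) a b c t x s

text \<open>The amalgamated subgroup is parametrised by \<open>\<int>\<close> via \<open>n \<mapsto> a\<^sup>n\<close> and \<open>n \<mapsto> x\<^sup>n\<close>.\<close>

definition gersten_amalgam :: "(gersten_gen word set + torus_gen word set) word set monoid" where
  "gersten_amalgam =
     amalgamated_product integer_group
       (\<lambda>n::int. gersten_a [^]\<^bsub>gersten_group\<^esub> n) gersten_group
       (\<lambda>n::int. torus_x [^]\<^bsub>torus_group\<^esub> n) torus_group"

lemma group_gersten_group: "group gersten_group"
  unfolding gersten_group_def by (rule group_presented_group) simp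

lemma group_torus_group: "group torus_group"
  unfolding torus_group_def by (rule group_presented_group) simp

lemma word_class_closed: "word_class UNIV E w \<in> carrier (presented_group UNIV E)"
  by (auto simp: word_class_def presented_group_def carrier_FactGroup free_group_def)

lemma group_gersten_amalgam: "group gersten_amalgam"
proof -
  have "gersten_a [^]\<^bsub>gersten_group\<^esub> n \<in> carrier gersten_group" for n :: int
    using group.int_pow_closed[OF group_gersten_group] word_class_closed
    unfolding gersten_a_def gersten_group_def by blast
  moreover have "torus_x [^]\<^bsub>torus_group\<^esub> n \<in> carrier torus_group" for n :: int
    using group.int_pow_closed[OF group_torus_group] word_class_closed
    unfolding torus_x_def torus_group_def by blast
  ultimately show ?thesis
    unfolding gersten_amalgam_def amalgamated_product_def
    by (intro group_presented_group)
       (auto simp: mult_relations_def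
          intro!: monoid.m_closed[OF group.is_monoid] group_gersten_group group_torus_group)
qed

end

theory Submission
  imports Defs
begin

text \<open>Let \<open>G\<close> be the amalgam, generated by \<open>a, b, c, t, s\<close>, and suppose that \<open>h : H \<rightarrow> \<int>\<close> has free
  kernel \<open>K\<close> for a subgroup \<open>H\<close> of finite index.  Two observations exclude each other.

  First, \<open>h\<close> vanishes on the powers of \<open>a\<close> that lie in every conjugate of \<open>H\<close>.  The relations say
  that \<open>t\<close>, \<open>a t\<close> and \<open>a\<^sup>2 t\<close> are conjugate in \<open>G\<close>.  Summing the squares of \<open>u \<mapsto> h (r u r\<inverse>)\<close> over
  representatives \<open>r\<close> of the cosets of \<open>H\<close> gives a conjugation-invariant function on the normal core
  of \<open>H\<close> that is a quadratic form on the powers of \<open>a\<close> and \<open>t\<close>.  It takes equal values at three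
  equally spaced points of a line in the direction of \<open>a\<close>, so it vanishes in that
  direction (\<open>character_pow_eq_0\<close>).

  Second, a power \<open>A\<close> of \<open>a\<close> that lies in \<open>K\<close> is nontrivial, and its centraliser in \<open>K\<close> contains all
  commutators of suitable powers of \<open>t\<close> and \<open>s\<close>.  These do not all commute, since \<open>t\<close> and \<open>s\<close> generate a
  free group, whereas centralisers of nontrivial elements of a free group are abelian
  (\<open>is_free_group_centralizer_abelian\<close>).  That \<open>a\<close> has infinite order is seen in the Heisenberg group,
  and that the commutators do not commute is seen in the special linear group of degree two.

  The amalgam is tubular because the Gersten group is a double HNN extension of \<open>\<langle>a, t\<rangle>\<close> with
  stable letters \<open>b\<close> and \<open>c\<close> that conjugate \<open>a t\<close> and \<open>a\<^sup>2 t\<close> to \<open>t\<close>.  All homomorphisms needed for this and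
  for the maps to the test groups are given by values on generators
  (\<open>hom_from_generators\<close>).\<close>

section \<open>Homomorphisms out of presented groups\<close>

definition letter_value :: "('a, 'm) monoid_scheme \<Rightarrow> ('x \<Rightarrow> 'a) \<Rightarrow> 'x \<times> bool \<Rightarrow> 'a" where
  "letter_value G f p = (if snd p then f (fst p) else inv\<^bsub>G\<^esub> f (fst p))"

definition word_value :: "('a, 'm) monoid_scheme \<Rightarrow> ('x \<Rightarrow> 'a) \<Rightarrow> 'x word \<Rightarrow> 'a" where
  "word_value G f w = foldr (\<lambda>p y. letter_value G f p \<otimes>\<^bsub>G\<^esub> y) w \<one>\<^bsub>G\<^esub>"

abbreviation letters :: "'x word \<Rightarrow> 'x set" where
  "letters w \<equiv> fst ` set w"

lemma word_value_Nil [simp]: "word_value G f [] = \<one>\<^bsub>G\<^esub>"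
  by (simp add: word_value_def)

lemma word_value_Cons: "word_value G f (p # w) = letter_value G f p \<otimes>\<^bsub>G\<^esub> word_value G f w"
  by (simp add: word_value_def)

lemma letter_value_simps [simp]:
  "letter_value G f (pos y) = f y" "letter_value G f (neg y) = inv\<^bsub>G\<^esub> f y"
  by (simp_all add: letter_value_def)

context group
begin

lemma letter_value_closed: "f \<in> X \<rightarrow> carrier G \<Longrightarrow> fst p \<in> X \<Longrightarrow> letter_value G f p \<in> carrier G"
  by (auto simp: letter_value_def)

lemma letter_value_flip:
  "f \<in> X \<rightarrow> carrier G \<Longrightarrow> fst p \<in> X \<Longrightarrow> letter_value G f (flip p) = inv (letter_value G f p)"
  by (auto simp: letter_value_def flip_def Pi_iff)

lemma word_value_closed: "f \<in> X \<rightarrow> carrier G \<Longrightarrow> letters w \<subseteq> X \<Longrightarrow> word_value G f w \<in> carrier G"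
proof (induction w)
  case (Cons p w)
  then show ?case using letter_value_closed[of f X p] by (simp add: word_value_Cons)
qed simp

lemma word_value_append:
  assumes "f \<in> X \<rightarrow> carrier G" "letters u \<subseteq> X" "letters v \<subseteq> X"
  shows "word_value G f (u @ v) = word_value G f u \<otimes> word_value G f v"
  using assms(2)
proof (induction u)
  case Nil
  then show ?case using word_value_closed[OF assms(1,3)] by simp
next
  case (Cons p u)
  then show ?case
    using word_value_closed[OF assms(1,3)] word_value_closed[OF assms(1), of u]
      letter_value_closed[OF assms(1), of p]
    by (simp add: word_value_Cons m_assoc)
qed

lemma word_value_inv:
  assumes "f \<in> X \<rightarrow> carrier G" "letters w \<subseteq> X"
  shows "word_value G f (word_inv w) = inv (word_value G f w)"
  using assms(2)
proof (induction w)
  case Nil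
  then show ?case by (simp add: word_inv_def)
next
  case (Cons p w)
  have 1: "word_inv (p # w) = word_inv w @ [flip p]" by (simp add: word_inv_def)
  have "letters (word_inv w) \<subseteq> X" "letters [flip p] \<subseteq> X" using Cons.prems by simp_all
  then have "word_value G f (word_inv (p # w))
      = word_value G f (word_inv w) \<otimes> word_value G f [flip p]"
    unfolding 1 by (rule word_value_append[OF assms(1)])
  also have "\<dots> = inv (word_value G f w) \<otimes> inv (letter_value G f p)"
    using Cons letter_value_closed[OF assms(1), of p] letter_value_flip[OF assms(1), of p]
    by (simp add: word_value_Cons)
  also have "\<dots> = inv (word_value G f (p # w))"
    using Cons.prems word_value_closed[OF assms(1), of w] letter_value_closed[OF assms(1), of p]
    by (simp add: word_value_Cons inv_mult_group)
  finally show ?case .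
qed

lemma word_value_push:
  assumes "f \<in> X \<rightarrow> carrier G" "letters w \<subseteq> X" "fst p \<in> X"
  shows "word_value G f (push p w) = letter_value G f p \<otimes> word_value G f w"
proof (cases "\<exists>w'. w = flip p # w'")
  case True
  then obtain w' where w: "w = flip p # w'" by blast
  show ?thesis
    using assms w word_value_closed[OF assms(1), of w'] letter_value_closed[OF assms(1,3)]
      letter_value_flip[OF assms(1,3)]
    by (simp add: word_value_Cons inv_solve_left flip: m_assoc)
next
  case False
  then have "push p w = p # w" by (cases w) simp_all
  then show ?thesis by (simp add: word_value_Cons)
qed

lemma word_value_reduce:
  assumes "f \<in> X \<rightarrow> carrier G" "letters w \<subseteq> X"
  shows "word_value G f (reduce w) = word_value G f w"
  using assms(2)
proof (induction w)
  case Nil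
  then show ?case by (simp add: reduce_def)
next
  case (Cons p w)
  then have "letters (reduce w) \<subseteq> X" by (intro letters_reduce) simp
  then show ?case
    using Cons word_value_push[OF assms(1), of "reduce w" p]
    by (simp add: reduce_def word_value_Cons)
qed

lemma word_value_hom:
  assumes "f \<in> X \<rightarrow> carrier G"
  shows "word_value G f \<in> hom (free_group X) G"
proof (rule homI)
  show "word_value G f w \<in> carrier G" if "w \<in> carrier (free_group X)" for w
    using that by (intro word_value_closed[OF assms]) (simp add: free_group_def)
  show "word_value G f (u \<otimes>\<^bsub>free_group X\<^esub> v) = word_value G f u \<otimes> word_value G f v"
    if "u \<in> carrier (free_group X)" "v \<in> carrier (free_group X)" for u v
    using that word_value_reduce[OF assms, of "u @ v"] word_value_append[OF assms, of u v]
    by (simp add: free_group_def image_Un)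
qed

lemma hom_word_value:
  assumes "group H" "\<phi> \<in> hom G H" "f \<in> X \<rightarrow> carrier G" "letters w \<subseteq> X"
  shows "\<phi> (word_value G f w) = word_value H (\<lambda>y. \<phi> (f y)) w"
proof -
  interpret \<phi>: group_hom G H \<phi>
    using assms(1,2) by (simp add: group_hom_def group_hom_axioms_def)
  have "\<phi> (letter_value G f p) = letter_value H (\<lambda>y. \<phi> (f y)) p" if "fst p \<in> X" for p
    using that assms(3) by (auto simp: letter_value_def Pi_iff)
  then show ?thesis
    using assms(4)
  proof (induction w)
    case (Cons p w)
    then show ?case
      using letter_value_closed[OF assms(3), of p] word_value_closed[OF assms(3), of w]
      by (simp add: word_value_Cons)
  qed simp
qed

end

locale presentation =
  fixes X :: "'x set" and E :: "('x word \<times> 'x word) set"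
  assumes relation_letters: "(u, v) \<in> E \<Longrightarrow> letters u \<subseteq> X \<and> letters v \<subseteq> X"
begin

abbreviation P where "P \<equiv> presented_group X E"
abbreviation cls where "cls \<equiv> word_class X E"
abbreviation gen where "gen y \<equiv> word_class X E [pos y]"

sublocale F: group "free_group X" by (rule group_free_group)

lemma relators_closed: "(\<lambda>(u, v). reduce (u @ word_inv v)) ` E \<subseteq> carrier (free_group X)"
proof -
  have "reduce (u @ word_inv v) \<in> carrier (free_group X)" if "(u, v) \<in> E" for u v
    using letters_reduce[of "u @ word_inv v" X] relation_letters[OF that]
    by (simp add: free_group_def image_Un)
  then show ?thesis by auto
qed

lemma relator_closure_normal: "relator_closure X E \<lhd> free_group X"
  unfolding relator_closure_def by (rule F.normal_closure_normal[OF relators_closed])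

lemma group_P: "group P"
  by (rule group_presented_group) (rule relation_letters)

sublocale P: group P by (rule group_P)

lemma cls_hom: "r_coset (free_group X) (relator_closure X E) \<in> hom (free_group X) P"
  using normal.r_coset_hom_Mod[OF relator_closure_normal] by (simp add: presented_group_def)

lemma reduce_closed: "letters w \<subseteq> X \<Longrightarrow> reduce w \<in> carrier (free_group X)"
  by (simp add: free_group_def letters_reduce)

lemma cls_closed: "letters w \<subseteq> X \<Longrightarrow> cls w \<in> carrier P"
  using hom_in_carrier[OF cls_hom reduce_closed] by (simp add: word_class_def)

lemma gen_closed: "y \<in> X \<Longrightarrow> gen y \<in> carrier P"
  by (rule cls_closed) simp

lemma cls_append:
  assumes "letters u \<subseteq> X" "letters v \<subseteq> X"
  shows "cls (u @ v) = cls u \<otimes>\<^bsub>P\<^esub> cls v"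
  using hom_mult[OF cls_hom reduce_closed[OF assms(1)] reduce_closed[OF assms(2)]]
  by (simp add: word_class_def free_group_def)

lemma cls_Nil: "cls [] = \<one>\<^bsub>P\<^esub>"
  using hom_one[OF cls_hom F.is_group P.is_group]
  by (simp add: word_class_def free_group_def reduce_def)

lemma cls_neg: "y \<in> X \<Longrightarrow> cls [neg y] = inv\<^bsub>P\<^esub> gen y"
proof -
  assume y: "y \<in> X"
  have "cls [neg y] \<otimes>\<^bsub>P\<^esub> gen y = cls ([neg y] @ [pos y])"
    using y by (intro cls_append[symmetric]) simp_all
  also have "\<dots> = \<one>\<^bsub>P\<^esub>"
    by (simp add: word_class_def reduce_def flip_def flip: cls_Nil)
  finally show ?thesis
    using y P.inv_equality[of "cls [neg y]" "gen y"] by (simp add: cls_closed)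
qed

lemma cls_word_value: "letters w \<subseteq> X \<Longrightarrow> cls w = word_value P gen w"
proof (induction w)
  case Nil
  then show ?case by (simp add: cls_Nil)
next
  case (Cons p w)
  then have "cls (p # w) = cls [p] \<otimes>\<^bsub>P\<^esub> cls w"
    using cls_append[of "[p]" w] by simp
  moreover have "cls [p] = letter_value P gen p"
    using Cons.prems cls_neg by (cases p; cases "snd p") auto
  ultimately show ?case using Cons by (simp add: word_value_Cons)
qed

lemma carrier_cls:
  assumes "g \<in> carrier P"
  obtains w where "letters w \<subseteq> X" "g = cls w"
proof -
  obtain w where "w \<in> carrier (free_group X)" "g = relator_closure X E #>\<^bsub>free_group X\<^esub> w"
    using assms by (auto simp: presented_group_def carrier_FactGroup)
  then show thesis
    by (intro that[of w]) (auto simp: free_group_def word_class_def reduce_id)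
qed

text \<open>The relator \<open>u v\<inverse>\<close> lies in the subgroup that is divided out.  The conclusion is phrased with
  \<^const>\<open>word_value\<close> so that unfolding a concrete word yields an equation between products of
  generators in the presented group.\<close>

lemma cls_relation:
  assumes "(u, v) \<in> E"
  shows "word_value P gen u = word_value P gen v"
proof -
  have uv: "letters u \<subseteq> X" "letters v \<subseteq> X" using relation_letters[OF assms] by auto
  have gen: "gen \<in> X \<rightarrow> carrier P" by (auto intro: gen_closed)
  have rel: "reduce (u @ word_inv v) \<in> relator_closure X E"
    using assms by (auto simp: relator_closure_def normal_closure_def)
  have "cls (u @ word_inv v) = relator_closure X E"
    unfolding word_class_def
    using rel normal_imp_subgroup[OF relator_closure_normal]
    by (simp add: F.coset_join2 subgroup.mem_carrier)
  then have "cls (u @ word_inv v) = \<one>\<^bsub>P\<^esub>"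
    by (simp add: presented_group_def FactGroup_def)
  moreover have "cls (u @ word_inv v) = cls u \<otimes>\<^bsub>P\<^esub> cls (word_inv v)"
    using uv by (intro cls_append) simp_all
  ultimately have "word_value P gen u \<otimes>\<^bsub>P\<^esub> inv\<^bsub>P\<^esub> word_value P gen v = \<one>\<^bsub>P\<^esub>"
    using uv by (simp add: cls_word_value P.word_value_inv[OF gen])
  then show ?thesis
    using P.word_value_closed[OF gen] uv by (simp add: P.inv_solve_right')
qed

text \<open>Von Dyck's theorem: the evaluation homomorphism of the free group kills the relators, hence the
  normal subgroup that they generate, and factors through the quotient.\<close>

lemma hom_from_generators:
  assumes "group G" and f: "f \<in> X \<rightarrow> carrier G"
    and rels: "\<And>u v. (u, v) \<in> E \<Longrightarrow> word_value G f u = word_value G f v"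
  obtains \<phi> where "\<phi> \<in> hom P G" "\<And>y. y \<in> X \<Longrightarrow> \<phi> (gen y) = f y"
proof -
  interpret G: group G by fact
  interpret ev: group_hom "free_group X" G "word_value G f"
    using G.word_value_hom[OF f] by (simp add: group_hom_def group_hom_axioms_def)
  have "reduce (u @ word_inv v) \<in> kernel (free_group X) G (word_value G f)" if "(u, v) \<in> E" for u v
  proof -
    have uv: "letters u \<subseteq> X" "letters v \<subseteq> X" using relation_letters[OF that] by auto
    then have "word_value G f (reduce (u @ word_inv v)) = word_value G f u \<otimes>\<^bsub>G\<^esub> inv\<^bsub>G\<^esub> word_value G f v"
      using G.word_value_reduce[OF f, of "u @ word_inv v"] G.word_value_append[OF f, of u "word_inv v"]
      by (simp add: image_Un G.word_value_inv[OF f])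
    also have "\<dots> = \<one>\<^bsub>G\<^esub>"
      using G.word_value_closed[OF f] uv rels[OF that] by simp
    finally show ?thesis
      using uv reduce_closed[of "u @ word_inv v"] by (simp add: kernel_def image_Un)
  qed
  then have "relator_closure X E \<subseteq> kernel (free_group X) G (word_value G f)"
    using ev.normal_kernel unfolding relator_closure_def normal_closure_def by auto
  then obtain \<phi> where \<phi>: "\<phi> \<in> hom (free_group X Mod relator_closure X E) G"
    "\<And>w. w \<in> carrier (free_group X) \<Longrightarrow> \<phi> (relator_closure X E #>\<^bsub>free_group X\<^esub> w) = word_value G f w"
    using ev.FactGroup_universal_kernel[OF relator_closure_normal] by blast
  have "\<phi> (gen y) = f y" if "y \<in> X" for y
    using that \<phi>(2)[of "[pos y]"] f
    by (auto simp: word_class_def free_group_def reduce_id reduced_def word_value_Cons Pi_iff)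
  then show thesis using \<phi>(1) that by (simp add: presented_group_def)
qed

lemma hom_ext:
  assumes "group G" "\<phi> \<in> hom P G" "\<psi> \<in> hom P G"
    and "\<And>y. y \<in> X \<Longrightarrow> \<phi> (gen y) = \<psi> (gen y)" and "g \<in> carrier P"
  shows "\<phi> g = \<psi> g"
proof -
  interpret G: group G by fact
  have gen: "gen \<in> X \<rightarrow> carrier P" by (auto intro: gen_closed)
  obtain w where w: "letters w \<subseteq> X" "g = cls w" using carrier_cls[OF assms(5)] .
  have "word_value G (\<lambda>y. \<phi> (gen y)) w = word_value G (\<lambda>y. \<psi> (gen y)) w"
    using w(1)
  proof (induction w)
    case (Cons p w)
    then show ?case using assms(4)[of "fst p"] by (simp add: word_value_Cons letter_value_def)
  qed simp
  then show ?thesis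
    using w P.hom_word_value[OF assms(1) _ gen, of _ w] assms(2,3) by (simp add: cls_word_value)
qed

end

text \<open>Both isomorphisms of the file are obtained in this way: the homomorphisms come from
  presentations, and the two composites are compared with the identity on generators only.\<close>

lemma iso_by_inverse_homs:
  assumes "\<phi> \<in> hom G H" "\<psi> \<in> hom H G"
    and "\<And>g. g \<in> carrier G \<Longrightarrow> \<psi> (\<phi> g) = g" "\<And>h. h \<in> carrier H \<Longrightarrow> \<phi> (\<psi> h) = h"
  shows "G \<cong> H"
  by (rule is_isoI, rule group_isomorphisms_imp_iso[of _ _ _ \<psi>])
     (use assms in \<open>auto simp: group_isomorphisms_def\<close>)

section \<open>Centralisers in free groups\<close>

text \<open>Two words that commute with \<open>u\<close> are prefixes of powers of \<open>u\<close>, so the shorter one is a prefix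
  of the longer one.  The remainder of the longer one commutes with \<open>u\<close> again, and induction applies.\<close>

lemma comm_append_trans:
  assumes "u \<noteq> []" "u @ v = v @ u" "u @ w = w @ u"
  shows "v @ w = w @ v"
  using assms(2,3)
proof (induction "length v + length w" arbitrary: v w rule: less_induct)
  case less
  have power: "concat (replicate k u) @ y = y @ concat (replicate k u)" if "u @ y = y @ u" for k y
  proof (induction k)
    case (Suc k)
    have "concat (replicate (Suc k) u) @ y = u @ concat (replicate k u) @ y" by simp
    also have "\<dots> = (u @ y) @ concat (replicate k u)" using Suc by simp
    finally show ?case using that by simp
  qed simp
  have prefix: "y = take (length y) (concat (replicate k u))" if "u @ y = y @ u" "length y \<le> k" for k y
  proof -
    have "k \<le> length (concat (replicate k u))"
      using assms(1) by (induction k) (auto simp: Suc_le_eq add_strict_increasing)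
    then have "take (length y) (concat (replicate k u) @ y) = take (length y) (concat (replicate k u))"
      using that(2) by simp
    then show ?thesis unfolding power[OF that(1)] by simp
  qed
  have step: "y @ z = z @ y"
    if "length y \<le> length z" "u @ y = y @ u" "u @ z = z @ u" "length y + length z = length v + length w" for y z
  proof (cases "y = []")
    case False
    have "y = take (length y) z"
      using prefix[OF that(2,1)] prefix[OF that(3) order_refl] that(1)
      by (metis min.absorb1 take_take)
    then obtain z' where z: "z = y @ z'" by (metis append_take_drop_id)
    have "y @ (u @ z') = y @ (z' @ u)"
      using that(2,3) unfolding z by (metis append.assoc)
    then have "u @ z' = z' @ u" by simp
    then have "y @ z' = z' @ y"
      using less.hyps[of y z'] that(2,4) False unfolding z by (simp flip: length_greater_0_conv)
    then show ?thesis using z by simp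
  qed simp
  show ?case
    using step[of v w] step[of w v] less.prems by (cases "length v \<le> length w") simp_all
qed

lemma word_inv_simps [simp]:
  "word_inv [] = []" "word_inv (u @ v) = word_inv v @ word_inv u" "word_inv (word_inv u) = u"
  "word_inv u = [] \<longleftrightarrow> u = []"
  by (simp_all add: word_inv_def rev_map o_def)

lemma last_word_inv: "u \<noteq> [] \<Longrightarrow> last (word_inv u) = flip (hd u)"
  by (simp add: word_inv_def last_rev hd_map)

lemma flip_eq_iff: "flip p = q \<longleftrightarrow> p = flip q"
  by (auto simp: flip_def prod_eq_iff)

lemma reduced_word_inv: "reduced w \<Longrightarrow> reduced (word_inv w)"
  unfolding reduced_def word_inv_def successively_rev successively_map
  by (erule successively_mono) (auto simp: flip_eq_iff)

lemma reduced_append_iff: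
  "reduced (u @ v) \<longleftrightarrow> reduced u \<and> reduced v \<and> (u \<noteq> [] \<and> v \<noteq> [] \<longrightarrow> hd v \<noteq> flip (last u))"
  by (auto simp: reduced_def successively_append_iff)

lemma length_reduce_le: "length (reduce w) \<le> length w"
proof (induction w)
  case (Cons p w)
  have "length (push p y) \<le> Suc (length y)" for y by (cases y) auto
  then show ?case using Cons order_trans by (fastforce simp: reduce_def)
qed (simp add: reduce_def)

lemma reduce_same_length: "length (reduce w) = length w \<Longrightarrow> reduce w = w"
proof (induction w)
  case (Cons p w)
  have push: "length (push p y) \<le> Suc (length y) \<and> (length (push p y) = Suc (length y) \<longrightarrow> push p y = p # y)" for y
    by (cases y) auto
  have "reduce (p # w) = push p (reduce w)" by (simp add: reduce_def)
  then show ?case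
    using Cons push[of "reduce w"] length_reduce_le[of w] by (metis Suc_le_mono le_antisym length_Cons)
qed (simp add: reduce_def)

text \<open>If one of two products of commuting elements is free of cancellation, then so is the
  other, because both have the same reduced form and the same length before reduction.  Commutation in the
  free group thus becomes commutation of lists.\<close>

lemma commuting_words_append:
  assumes "reduced (u @ v)" "reduce (u @ v) = reduce (v @ u)"
  shows "u @ v = v @ u"
proof -
  have "reduce (v @ u) = u @ v" using assms by (simp add: reduce_id)
  then show ?thesis using reduce_same_length[of "v @ u"] by simp
qed

lemma (in group) commute_inv_left:
  assumes "g \<in> carrier G" "h \<in> carrier G" "g \<otimes> h = h \<otimes> g"
  shows "inv g \<otimes> h = h \<otimes> inv g"
  using assms by (metis inv_closed inv_solve_left inv_solve_right m_assoc m_closed)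

lemma inv_free_group:
  assumes "w \<in> carrier (free_group X)"
  shows "inv\<^bsub>free_group X\<^esub> w = word_inv w"
proof (rule group.inv_equality[OF group_free_group])
  show "word_inv w \<in> carrier (free_group X)"
    using assms by (simp add: free_group_def reduced_word_inv)
qed (use assms reduce_word_inv_left in \<open>auto simp: free_group_def\<close>)

text \<open>Cancellation in \<open>u v\<close> requires \<open>v\<close> to begin with the inverse of the last letter of \<open>u\<close>,
  cancellation in \<open>u\<inverse> v\<close> requires it to begin with the first letter of \<open>u\<close>.  If \<open>u\<close> is cyclically
  reduced, both cannot happen.\<close>

lemma cyclically_reduced_commute:
  assumes u: "u \<in> carrier (free_group X)" "u \<noteq> []" "last u \<noteq> flip (hd u)"
    and v: "v \<in> carrier (free_group X)" "u \<otimes>\<^bsub>free_group X\<^esub> v = v \<otimes>\<^bsub>free_group X\<^esub> u"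
  shows "u @ v = v @ u \<or> u @ word_inv v = word_inv v @ u"
proof (cases "reduced (u @ v)")
  case True
  then show ?thesis using v(2) commuting_words_append[of u v] by (simp add: free_group_def)
next
  case False
  interpret F: group "free_group X" by (rule group_free_group)
  have ru: "reduced u" and rv: "reduced v" using u(1) v(1) by (simp_all add: free_group_def)
  with False have "hd v = flip (last u)" by (auto simp: reduced_append_iff)
  then have "reduced (word_inv u @ v)"
    using ru rv u(2,3) by (auto simp: reduced_append_iff reduced_word_inv last_word_inv flip_eq_iff)
  moreover have "reduce (word_inv u @ v) = reduce (v @ word_inv u)"
    using F.commute_inv_left[OF u(1) v] u(1) by (simp add: inv_free_group) (simp add: free_group_def)
  ultimately have "word_inv u @ v = v @ word_inv u" by (rule commuting_words_append)
  then have "word_inv (word_inv u @ v) = word_inv (v @ word_inv u)" by (rule arg_cong)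
  then show ?thesis by simp
qed

text \<open>By conjugation \<open>u\<close> may be taken cyclically reduced: as long as its last letter is the inverse
  of its first letter, conjugating by that letter shortens \<open>u\<close> by two.  For cyclically reduced \<open>u\<close>
  each element of the centraliser, or its inverse, commutes with \<open>u\<close> as a list, and for lists
  commuting with a fixed nonempty list is transitive.\<close>

lemma free_group_centralizer_abelian:
  assumes "u \<in> carrier (free_group X)" "u \<noteq> []"
    and "v \<in> carrier (free_group X)" "u \<otimes>\<^bsub>free_group X\<^esub> v = v \<otimes>\<^bsub>free_group X\<^esub> u"
    and "w \<in> carrier (free_group X)" "u \<otimes>\<^bsub>free_group X\<^esub> w = w \<otimes>\<^bsub>free_group X\<^esub> u"
  shows "v \<otimes>\<^bsub>free_group X\<^esub> w = w \<otimes>\<^bsub>free_group X\<^esub> v"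
  using assms
proof (induction "length u" arbitrary: u v w rule: less_induct)
  case less
  let ?F = "free_group X"
  interpret F: group ?F by (rule group_free_group)
  show ?case
  proof (cases "last u = flip (hd u)")
    case False
    have inv_carrier: "word_inv y \<in> carrier ?F" if "y \<in> carrier ?F" for y
      using that inv_free_group[OF that] F.inv_closed[OF that] by simp
    have "\<exists>v' \<in> {v, word_inv v}. u @ v' = v' @ u"
      using cyclically_reduced_commute[OF less.prems(1,2) False less.prems(3,4)] by blast
    then obtain v' where v': "v' \<in> {v, word_inv v}" "u @ v' = v' @ u" ..
    have "\<exists>w' \<in> {w, word_inv w}. u @ w' = w' @ u"
      using cyclically_reduced_commute[OF less.prems(1,2) False less.prems(5,6)] by blast
    then obtain w' where w': "w' \<in> {w, word_inv w}" "u @ w' = w' @ u" ..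
    have comm: "v' \<otimes>\<^bsub>?F\<^esub> w' = w' \<otimes>\<^bsub>?F\<^esub> v'"
      using comm_append_trans[OF less.prems(2) v'(2) w'(2)] by (simp add: free_group_def)
    have v'c: "v' \<in> carrier ?F" and w'c: "w' \<in> carrier ?F"
      using v'(1) w'(1) less.prems(3,5) inv_carrier by blast+
    have "v = v' \<or> v = inv\<^bsub>?F\<^esub> v'" "w = w' \<or> w = inv\<^bsub>?F\<^esub> w'"
      using v'(1) w'(1) inv_free_group[OF v'c] inv_free_group[OF w'c] by auto
    moreover have 1: "inv\<^bsub>?F\<^esub> v' \<otimes>\<^bsub>?F\<^esub> w' = w' \<otimes>\<^bsub>?F\<^esub> inv\<^bsub>?F\<^esub> v'"
      by (rule F.commute_inv_left[OF v'c w'c comm])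
    moreover have "inv\<^bsub>?F\<^esub> w' \<otimes>\<^bsub>?F\<^esub> v' = v' \<otimes>\<^bsub>?F\<^esub> inv\<^bsub>?F\<^esub> w'"
      by (rule F.commute_inv_left[OF w'c v'c comm[symmetric]])
    moreover have "inv\<^bsub>?F\<^esub> w' \<otimes>\<^bsub>?F\<^esub> inv\<^bsub>?F\<^esub> v' = inv\<^bsub>?F\<^esub> v' \<otimes>\<^bsub>?F\<^esub> inv\<^bsub>?F\<^esub> w'"
      by (rule F.commute_inv_left[OF w'c F.inv_closed[OF v'c] 1[symmetric]])
    ultimately show ?thesis using comm by metis
  next
    case True
    define p where "p = hd u"
    obtain y where y: "u = p # y @ [flip p]"
    proof -
      have "u = p # tl u" using less.prems(2) by (simp add: p_def)
      moreover have "tl u \<noteq> []"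
      proof
        assume "tl u = []"
        then have "u = [p]" using calculation by simp
        then show False using True by simp
      qed
      moreover from this have "last (tl u) = flip p" using True by (simp add: last_tl p_def)
      ultimately show thesis using that[of "butlast (tl u)"] append_butlast_last_id[of "tl u"] by metis
    qed
    have red: "reduced u" and lets: "letters u \<subseteq> X" using less.prems(1) by (auto simp: free_group_def)
    have ry': "reduced (y @ [flip p])" using red y reduced_ConsD by blast
    then have ry: "reduced y" by (simp add: reduced_append_iff)
    have pF: "[p] \<in> carrier ?F" using lets y by (simp add: free_group_def reduced_def)
    have pF': "inv\<^bsub>?F\<^esub> [p] = [flip p]" using pF by (simp add: inv_free_group) (simp add: word_inv_def)
    have ne: "y \<noteq> []" using red y by (auto simp: reduced_def)
    have yF: "y \<in> carrier ?F" using ry lets y by (simp add: free_group_def)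
    \<comment> \<open>conjugation by the first letter of \<open>u\<close>, an injective homomorphism that takes \<open>u\<close> to \<open>y\<close>\<close>
    define conj where "conj g = inv\<^bsub>?F\<^esub> [p] \<otimes>\<^bsub>?F\<^esub> g \<otimes>\<^bsub>?F\<^esub> [p]" for g
    have conj_closed: "conj g \<in> carrier ?F" if "g \<in> carrier ?F" for g
      using that pF by (simp add: conj_def)
    have conj_mult: "conj (g \<otimes>\<^bsub>?F\<^esub> h) = conj g \<otimes>\<^bsub>?F\<^esub> conj h" if "g \<in> carrier ?F" "h \<in> carrier ?F" for g h
    proof -
      have "[p] \<otimes>\<^bsub>?F\<^esub> (inv\<^bsub>?F\<^esub> [p] \<otimes>\<^bsub>?F\<^esub> (h \<otimes>\<^bsub>?F\<^esub> [p])) = h \<otimes>\<^bsub>?F\<^esub> [p]"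
        using that pF by (simp flip: F.m_assoc)
      then show ?thesis using that pF by (simp add: conj_def F.m_assoc)
    qed
    have conj_inj: "g = h" if "g \<in> carrier ?F" "h \<in> carrier ?F" "conj g = conj h" for g h
      using that pF by (simp add: conj_def F.m_assoc)
    have "u = [p] \<otimes>\<^bsub>?F\<^esub> (y \<otimes>\<^bsub>?F\<^esub> inv\<^bsub>?F\<^esub> [p])"
      unfolding pF' using y red ry' by (simp add: free_group_def reduce_id)
    then have "conj u = inv\<^bsub>?F\<^esub> [p] \<otimes>\<^bsub>?F\<^esub> ([p] \<otimes>\<^bsub>?F\<^esub> (y \<otimes>\<^bsub>?F\<^esub> inv\<^bsub>?F\<^esub> [p])) \<otimes>\<^bsub>?F\<^esub> [p]"
      by (simp add: conj_def)
    also have "\<dots> = y"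
      using pF yF by (simp add: F.m_assoc flip: F.m_assoc[of "inv\<^bsub>?F\<^esub> [p]" "[p]"])
    finally have cu: "conj u = y" .
    have "conj v \<otimes>\<^bsub>?F\<^esub> conj w = conj w \<otimes>\<^bsub>?F\<^esub> conj v"
    proof (rule less.hyps[of y])
      show "y \<otimes>\<^bsub>?F\<^esub> conj v = conj v \<otimes>\<^bsub>?F\<^esub> y" "y \<otimes>\<^bsub>?F\<^esub> conj w = conj w \<otimes>\<^bsub>?F\<^esub> y"
        unfolding cu[symmetric] using less.prems conj_mult by metis+
    qed (use less.prems y ne yF conj_closed in auto)
    then show ?thesis
      using less.prems conj_mult conj_inj by (metis F.m_closed)
  qed
qed

lemma is_free_group_centralizer_abelian:
  fixes K :: "('a, 'm) monoid_scheme"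
  assumes "group K" "is_free_group K"
    and "u \<in> carrier K" "u \<noteq> \<one>\<^bsub>K\<^esub>" "v \<in> carrier K" "w \<in> carrier K"
    and "u \<otimes>\<^bsub>K\<^esub> v = v \<otimes>\<^bsub>K\<^esub> u" "u \<otimes>\<^bsub>K\<^esub> w = w \<otimes>\<^bsub>K\<^esub> u"
  shows "v \<otimes>\<^bsub>K\<^esub> w = w \<otimes>\<^bsub>K\<^esub> v"
proof -
  interpret K: group K by fact
  obtain X :: "'a set" where "free_group X \<cong> K" using assms(2) by (auto simp: is_free_group_def)
  then have "K \<cong> free_group X" by (rule group.iso_sym[OF group_free_group])
  then obtain \<phi> where "\<phi> \<in> iso K (free_group X)" by (auto simp: is_iso_def)
  then have \<phi>: "\<phi> \<in> hom K (free_group X)" and inj: "inj_on \<phi> (carrier K)"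
    by (auto simp: iso_def bij_betw_def)
  have one: "\<phi> \<one>\<^bsub>K\<^esub> = []"
    using hom_one[OF \<phi> K.is_group group_free_group] by (simp add: free_group_def)
  then have "\<phi> u \<noteq> []" using inj_onD[OF inj, of u "\<one>\<^bsub>K\<^esub>"] assms(3,4) by auto
  moreover note hom_in_carrier[OF \<phi>] hom_mult[OF \<phi>, symmetric]
  ultimately have "\<phi> (v \<otimes>\<^bsub>K\<^esub> w) = \<phi> (w \<otimes>\<^bsub>K\<^esub> v)"
    using free_group_centralizer_abelian[of "\<phi> u" X "\<phi> v" "\<phi> w"] assms(3,5-8) by simp
  then show ?thesis using inj_onD[OF inj] assms(5,6) by simp
qed

section \<open>The Heisenberg group and the special linear group over the integers\<close>

text \<open>Unitriangular \<open>3 \<times> 3\<close> integer matrices, given by their entries above the diagonal.  In this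
  group \<open>a\<close> may be sent to a generator of the centre and \<open>t\<close>, \<open>b\<close> to the standard generators; sending \<open>c\<close>
  to the image of \<open>b\<^sup>2\<close> then satisfies the third Gersten relation.  So \<open>a\<close> has infinite order.\<close>

definition heisenberg :: "(int \<times> int \<times> int) monoid" where
  "heisenberg = \<lparr>carrier = UNIV,
     monoid.mult = (\<lambda>(p, q, r) (p', q', r'). (p + p', q + q', r + r' + p * q')), one = (0, 0, 0)\<rparr>"

lemma heisenberg_simps [simp]:
  "carrier heisenberg = UNIV"
  "(p, q, r) \<otimes>\<^bsub>heisenberg\<^esub> (p', q', r') = (p + p', q + q', r + r' + p * q')"
  "\<one>\<^bsub>heisenberg\<^esub> = (0, 0, 0)"
  by (simp_all add: heisenberg_def)

lemma group_heisenberg [simp]: "group heisenberg"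
proof (rule groupI)
  show "\<exists>h \<in> carrier heisenberg. h \<otimes>\<^bsub>heisenberg\<^esub> g = \<one>\<^bsub>heisenberg\<^esub>" for g
    by (cases g, rule bexI[of _ "(- fst g, - fst (snd g), fst g * fst (snd g) - snd (snd g))"]) auto
qed (auto simp: algebra_simps)

lemma heisenberg_centre_pow: "(0, 0, 1) [^]\<^bsub>heisenberg\<^esub> (n :: nat) = (0, 0, int n)"
  by (induction n) (simp_all add: nat_pow_def)

text \<open>A quadruple lists the entries of a \<open>2 \<times> 2\<close> matrix row by row.  This group detects that \<open>t\<close> and \<open>s\<close>
  do not satisfy a certain law: killing \<open>a\<close>, \<open>b\<close>, \<open>c\<close> leaves no relation between \<open>t\<close> and \<open>s\<close>, which may
  therefore be sent to the two elementary unipotent matrices.\<close>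

definition SL2Z :: "(int \<times> int \<times> int \<times> int) monoid" where
  "SL2Z = \<lparr>carrier = {(p, q, r, s). p * s - q * r = 1},
     monoid.mult = (\<lambda>(p, q, r, s) (p', q', r', s').
       (p * p' + q * r', p * q' + q * s', r * p' + s * r', r * q' + s * s')),
     one = (1, 0, 0, 1)\<rparr>"

lemma SL2Z_simps [simp]:
  "(p, q, r, s) \<in> carrier SL2Z \<longleftrightarrow> p * s - q * r = 1"
  "(p, q, r, s) \<otimes>\<^bsub>SL2Z\<^esub> (p', q', r', s')
     = (p * p' + q * r', p * q' + q * s', r * p' + s * r', r * q' + s * s')"
  "\<one>\<^bsub>SL2Z\<^esub> = (1, 0, 0, 1)"
  by (simp_all add: SL2Z_def)

lemma group_SL2Z [simp]: "group SL2Z"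
proof (rule groupI)
  show "\<exists>h \<in> carrier SL2Z. h \<otimes>\<^bsub>SL2Z\<^esub> g = \<one>\<^bsub>SL2Z\<^esub>" if "g \<in> carrier SL2Z" for g
  proof -
    obtain p q r s where g: "g = (p, q, r, s)" by (cases g) auto
    show ?thesis
      using that unfolding g by (intro bexI[of _ "(s, - q, - r, p)"]) (auto simp: algebra_simps)
  qed
  show "g \<otimes>\<^bsub>SL2Z\<^esub> h \<in> carrier SL2Z" if gh: "g \<in> carrier SL2Z" "h \<in> carrier SL2Z" for g h
  proof -
    obtain p q r s p' q' r' s' where [simp]: "g = (p, q, r, s)" "h = (p', q', r', s')"
      by (cases g; cases h) auto
    have "(p * p' + q * r') * (r * q' + s * s') - (p * q' + q * s') * (r * p' + s * r')
        = (p * s - q * r) * (p' * s' - q' * r')" by algebra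
    then show ?thesis using gh by simp
  qed
qed (auto simp: algebra_simps)

lemma SL2Z_inv:
  assumes "p * s - q * r = 1"
  shows "inv\<^bsub>SL2Z\<^esub> (p, q, r, s) = (s, - q, - r, p)"
  by (rule group.inv_equality[OF group_SL2Z]) (use assms in \<open>auto simp: algebra_simps\<close>)

lemma SL2Z_unipotent_pow:
  "(1, 1, 0, 1) [^]\<^bsub>SL2Z\<^esub> (n :: nat) = (1, int n, 0, 1)"
  "(1, 0, 1, 1) [^]\<^bsub>SL2Z\<^esub> (n :: nat) = (1, 0, int n, 1)"
  by (induction n) (simp_all add: nat_pow_def)

definition commutator :: "('a, 'm) monoid_scheme \<Rightarrow> 'a \<Rightarrow> 'a \<Rightarrow> 'a" where
  "commutator G g h = g \<otimes>\<^bsub>G\<^esub> h \<otimes>\<^bsub>G\<^esub> inv\<^bsub>G\<^esub> g \<otimes>\<^bsub>G\<^esub> inv\<^bsub>G\<^esub> h"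

text \<open>The entries of both products are polynomials in \<open>n\<close>, and equality of the upper left entries
  reduces to \<open>n\<^sup>6 = 0\<close>.\<close>

lemma SL2Z_commutators_not_commute:
  fixes n :: nat
  assumes "n > 0"
  defines "t \<equiv> (1, 1, 0, 1) [^]\<^bsub>SL2Z\<^esub> n" and "s \<equiv> (1, 0, 1, 1) [^]\<^bsub>SL2Z\<^esub> n"
  shows "commutator SL2Z t s \<otimes>\<^bsub>SL2Z\<^esub> commutator SL2Z (t \<otimes>\<^bsub>SL2Z\<^esub> t) s
       \<noteq> commutator SL2Z (t \<otimes>\<^bsub>SL2Z\<^esub> t) s \<otimes>\<^bsub>SL2Z\<^esub> commutator SL2Z t s"
proof
  define k where "k = int n"
  assume eq: "commutator SL2Z t s \<otimes>\<^bsub>SL2Z\<^esub> commutator SL2Z (t \<otimes>\<^bsub>SL2Z\<^esub> t) s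
       = commutator SL2Z (t \<otimes>\<^bsub>SL2Z\<^esub> t) s \<otimes>\<^bsub>SL2Z\<^esub> commutator SL2Z t s"
  have ts: "t = (1, k, 0, 1)" "s = (1, 0, k, 1)" "t \<otimes>\<^bsub>SL2Z\<^esub> t = (1, 2 * k, 0, 1)"
    by (simp_all add: t_def s_def SL2Z_unipotent_pow k_def)
  have "k ^ 6 = 0"
    using eq unfolding ts commutator_def
    by (simp add: SL2Z_inv) algebra
  then show False using assms(1) by (simp add: k_def)
qed

section \<open>Conjugation-invariant quadratic forms from characters of finite-index subgroups\<close>

context group
begin

lemma inv_cancel:
  assumes "r \<in> carrier G" "y \<in> carrier G"
  shows "inv r \<otimes> (r \<otimes> y) = y" "r \<otimes> (inv r \<otimes> y) = y"
  using assms by (simp_all flip: m_assoc)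

lemma conj_nat_pow:
  assumes "r \<in> carrier G" "z \<in> carrier G"
  shows "(r \<otimes> z \<otimes> inv r) [^] (n :: nat) = r \<otimes> z [^] n \<otimes> inv r"
proof (induction n)
  case (Suc n)
  then show ?case using assms by (simp add: m_assoc inv_cancel)
qed (use assms in simp)

text \<open>By the pigeonhole principle two of the cosets of \<open>z\<^sup>0, \<dots>, z\<^sup>n\<close> coincide, where \<open>n\<close> is the index,
  so \<open>z\<^sup>l \<in> H\<close> for some \<open>1 \<le> l \<le> n\<close>.  The factorial is an exponent that serves all elements at once,
  in particular all conjugates of \<open>z\<close>.\<close>

lemma finite_index_pow_mem:
  assumes H: "subgroup H G" "finite (rcosets H)" and z: "z \<in> carrier G"
  shows "z [^] (fact (card (rcosets H)) :: nat) \<in> H"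
proof -
  let ?n = "card (rcosets H)" and ?f = "\<lambda>i :: nat. H #> z [^] i"
  interpret H: subgroup H G by fact
  have "\<not> inj_on ?f {0..?n}"
  proof
    assume "inj_on ?f {0..?n}"
    moreover have "?f ` {0..?n} \<subseteq> rcosets H"
      using z by (auto simp: RCOSETS_def)
    ultimately have "card {0..?n} \<le> ?n"
      using card_inj_on_le[OF _ _ H(2)] by blast
    then show False by simp
  qed
  then obtain i j where ij: "i < j" "j \<le> ?n" "?f i = ?f j"
    unfolding inj_on_def by (metis atLeastAtMost_iff linorder_neqE_nat)
  have "z [^] j \<in> ?f i"
    unfolding ij(3) using z by (intro rcos_self H(1)) simp
  then obtain k where k: "k \<in> H" "z [^] j = k \<otimes> z [^] i"
    by (auto simp: r_coset_def)
  have "z [^] (j - i) \<otimes> z [^] i = k \<otimes> z [^] i"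
    using z k(2) ij(1) by (simp add: nat_pow_mult)
  then have "z [^] (j - i) \<in> H"
    using k(1) z H.mem_carrier by simp
  moreover have "(j - i) dvd fact ?n"
    using ij by (intro dvd_fact) auto
  then obtain l where "fact ?n = (j - i) * l" ..
  moreover have "y [^] l \<in> H" if "y \<in> H" for y
    using that by (induction l) auto
  ultimately show ?thesis
    using z by (metis nat_pow_pow)
qed

definition core :: "'a set \<Rightarrow> 'a set" where
  "core H = {u \<in> carrier G. \<forall>r \<in> carrier G. r \<otimes> u \<otimes> inv r \<in> H}"

lemma finite_index_pow_core:
  assumes "subgroup H G" "finite (rcosets H)" "z \<in> carrier G"
  shows "z [^] (fact (card (rcosets H)) :: nat) \<in> core H"
proof -
  have "(r \<otimes> z \<otimes> inv r) [^] (fact (card (rcosets H)) :: nat) \<in> H" if "r \<in> carrier G" for r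
    using that assms by (intro finite_index_pow_mem) simp_all
  then show ?thesis using assms(3) by (simp add: core_def conj_nat_pow)
qed

text \<open>The character \<open>u \<mapsto> h (r u r\<inverse>)\<close> of the normal core of \<open>H\<close>.  It depends only on the coset
  \<open>C = H r\<close>, since a character is invariant under conjugation inside \<open>H\<close>; the choice of \<open>r\<close> is
  therefore immaterial.\<close>

definition coset_character :: "('a \<Rightarrow> int) \<Rightarrow> 'a set \<Rightarrow> 'a \<Rightarrow> int" where
  "coset_character h C u = (let r = SOME r. r \<in> C in h (r \<otimes> u \<otimes> inv r))"

context
  fixes H and h :: "'a \<Rightarrow> int"
  assumes H: "subgroup H G" and h: "h \<in> hom (G\<lparr>carrier := H\<rparr>) integer_group"
begin

lemma character_mult: "k \<in> H \<Longrightarrow> l \<in> H \<Longrightarrow> h (k \<otimes> l) = h k + h l"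
  using hom_mult[OF h] by simp

lemma character_inv: "k \<in> H \<Longrightarrow> h (inv k) = - h k"
proof -
  assume k: "k \<in> H"
  interpret H: subgroup H G by (rule H)
  have "h k + h (inv k) = h \<one>"
    using k character_mult[of k "inv k"] H.mem_carrier by simp
  moreover have "h \<one> + h \<one> = h \<one>" using character_mult[of \<one> \<one>] by simp
  ultimately show ?thesis by simp
qed

lemma coset_character_eq:
  assumes "C \<in> rcosets H" "r \<in> C" "u \<in> core H"
  shows "coset_character h C u = h (r \<otimes> u \<otimes> inv r)"
proof -
  interpret H: subgroup H G by (rule H)
  define q where "q = (SOME q. q \<in> C)"
  have q: "q \<in> C" unfolding q_def using assms(2) by (rule someI)
  obtain g where g: "g \<in> carrier G" "C = H #> g"
    using assms(1) by (auto simp: RCOSETS_def)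
  have rq: "r \<in> carrier G" "q \<in> carrier G"
    using q assms(2) r_coset_subset_G[OF H.subset g(1)] by (auto simp: g(2))
  have "C = H #> r"
    using assms(2) g repr_independence[OF _ g(1) H] by blast
  then obtain k where k: "k \<in> H" "q = k \<otimes> r"
    using q by (auto simp: r_coset_def)
  let ?v = "r \<otimes> u \<otimes> inv r"
  have uv: "u \<in> carrier G" "?v \<in> H" using assms(3) rq by (auto simp: core_def)
  have "q \<otimes> u \<otimes> inv q = k \<otimes> ?v \<otimes> inv k"
    using rq uv(1) k H.mem_carrier by (simp add: m_assoc inv_mult_group)
  then have "h (q \<otimes> u \<otimes> inv q) = h ?v"
    using k(1) uv(2) by (simp add: character_mult character_inv)
  then show ?thesis by (simp add: coset_character_def q_def)
qed

lemma core_conj: "u \<in> core H \<Longrightarrow> g \<in> carrier G \<Longrightarrow> g \<otimes> u \<otimes> inv g \<in> core H"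
proof -
  assume u: "u \<in> core H" and g: "g \<in> carrier G"
  have "r \<otimes> (g \<otimes> u \<otimes> inv g) \<otimes> inv r = (r \<otimes> g) \<otimes> u \<otimes> inv (r \<otimes> g)" if "r \<in> carrier G" for r
    using that u g by (simp add: core_def m_assoc inv_mult_group)
  then show ?thesis using u g by (simp add: core_def)
qed

lemma core_mult: "u \<in> core H \<Longrightarrow> v \<in> core H \<Longrightarrow> u \<otimes> v \<in> core H"
  and conj_mult: "u \<in> core H \<Longrightarrow> v \<in> core H \<Longrightarrow> r \<in> carrier G \<Longrightarrow>
    r \<otimes> (u \<otimes> v) \<otimes> inv r = (r \<otimes> u \<otimes> inv r) \<otimes> (r \<otimes> v \<otimes> inv r)"
proof -
  assume u: "u \<in> core H" and v: "v \<in> core H"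
  interpret H: subgroup H G by (rule H)
  have *: "r \<otimes> (u \<otimes> v) \<otimes> inv r = (r \<otimes> u \<otimes> inv r) \<otimes> (r \<otimes> v \<otimes> inv r)" if r: "r \<in> carrier G" for r
    using r u v by (simp add: core_def m_assoc inv_cancel)
  show "u \<otimes> v \<in> core H" using u v by (simp add: core_def *)
  show "r \<in> carrier G \<Longrightarrow> r \<otimes> (u \<otimes> v) \<otimes> inv r = (r \<otimes> u \<otimes> inv r) \<otimes> (r \<otimes> v \<otimes> inv r)"
    by (rule *)
qed

lemma rcoset_representative:
  assumes "C \<in> rcosets H"
  obtains r where "r \<in> C" "r \<in> carrier G"
proof -
  obtain r where "r \<in> carrier G" "C = H #> r" using assms by (auto simp: RCOSETS_def)
  then show thesis using rcos_self[OF _ H] that by blast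
qed

lemma coset_character_mult:
  assumes "C \<in> rcosets H" "u \<in> core H" "v \<in> core H"
  shows "coset_character h C (u \<otimes> v) = coset_character h C u + coset_character h C v"
proof -
  obtain r where r: "r \<in> C" "r \<in> carrier G" using rcoset_representative[OF assms(1)] .
  have "r \<otimes> u \<otimes> inv r \<in> H" "r \<otimes> v \<otimes> inv r \<in> H" using assms r by (auto simp: core_def)
  then show ?thesis
    using assms r by (simp add: coset_character_eq core_mult conj_mult character_mult)
qed

lemma rcosets_translate:
  assumes "C \<in> rcosets H" "g \<in> carrier G"
  shows "C #> g \<in> rcosets H" "(C #> g) #> inv g = C"
proof -
  interpret H: subgroup H G by (rule H)
  obtain r where r: "r \<in> carrier G" "C = H #> r" using assms(1) by (auto simp: RCOSETS_def)
  show "C #> g \<in> rcosets H"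
    using r assms(2) H.subset by (auto simp: RCOSETS_def coset_mult_assoc)
  show "(C #> g) #> inv g = C"
    using r assms(2) H.subset by (simp add: coset_mult_assoc m_assoc)
qed

text \<open>Since translation permutes the cosets, every symmetric function of the character values is
  invariant under conjugation by \<open>G\<close>.\<close>

lemma coset_character_conj:
  assumes "C \<in> rcosets H" "u \<in> core H" "g \<in> carrier G"
  shows "coset_character h C (g \<otimes> u \<otimes> inv g) = coset_character h (C #> g) u"
proof -
  obtain r where r: "r \<in> C" "r \<in> carrier G" using rcoset_representative[OF assms(1)] .
  have "r \<otimes> g \<in> C #> g" using r(1) by (auto simp: r_coset_def)
  then have "coset_character h (C #> g) u = h ((r \<otimes> g) \<otimes> u \<otimes> inv (r \<otimes> g))"
    using assms by (intro coset_character_eq rcosets_translate)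
  also have "(r \<otimes> g) \<otimes> u \<otimes> inv (r \<otimes> g) = r \<otimes> (g \<otimes> u \<otimes> inv g) \<otimes> inv r"
    using assms r by (simp add: core_def m_assoc inv_mult_group)
  finally show ?thesis
    using coset_character_eq[OF assms(1) r(1) core_conj[OF assms(2,3)]] by simp
qed

text \<open>For \<open>H\<close> of finite index, a quadratic form on every abelian subgroup of the normal core,
  invariant under conjugation by the whole group and vanishing only where every character does.
  It replaces the squared translation length of an action on a CAT(0) space.\<close>

definition square_sum :: "'a \<Rightarrow> int" where
  "square_sum u = (\<Sum>C \<in> rcosets H. (coset_character h C u)\<^sup>2)"

lemma square_sum_conj:
  assumes "u \<in> core H" "g \<in> carrier G"
  shows "square_sum (g \<otimes> u \<otimes> inv g) = square_sum u"
  unfolding square_sum_def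
  by (rule sum.reindex_bij_witness[of _ "\<lambda>C. C #> inv g" "\<lambda>C. C #> g"])
     (use assms rcosets_translate[of _ g] rcosets_translate[of _ "inv g"] coset_character_conj in auto)

text \<open>Gersten's argument.  The elements \<open>t\<close>, \<open>a t\<close> and \<open>a\<^sup>2 t\<close> are conjugate, so the invariant form
  takes one value at \<open>\<tau>\<close>, \<open>\<alpha> + \<tau>\<close> and \<open>2 \<alpha> + \<tau>\<close>, where \<open>\<alpha>\<close> and \<open>\<tau>\<close> are the vectors of character
  values of suitable powers of \<open>a\<close> and \<open>t\<close>.  A quadratic polynomial with equal values at
  \<open>0, 1, 2\<close> is constant, hence its leading coefficient \<open>\<Sum> \<alpha>\<^sup>2\<close> vanishes.  The character
  attached to the coset \<open>H\<close> is \<open>h\<close> itself.\<close>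

lemma character_pow_eq_0:
  assumes fin: "finite (rcosets H)"
    and [simp]: "a \<in> carrier G" "b \<in> carrier G" "c \<in> carrier G" "t \<in> carrier G"
    and comm: "t \<otimes> a = a \<otimes> t"
    and b: "b \<otimes> (a \<otimes> t) \<otimes> inv b = t" and c: "c \<otimes> (a \<otimes> a \<otimes> t) \<otimes> inv c = t"
  shows "h (a [^] (fact (card (rcosets H)) :: nat)) = 0"
proof -
  interpret H: subgroup H G by (rule H)
  define m :: nat where "m = fact (card (rcosets H))"
  define u where "u = a [^] m"
  define v where "v = t [^] m"
  have core: "z [^] m \<in> core H" if "z \<in> carrier G" for z
    unfolding m_def by (rule finite_index_pow_core[OF H fin that])
  have uv: "u \<in> core H" "v \<in> core H" unfolding u_def v_def by (simp_all add: core)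
  have at: "(a \<otimes> t) [^] m = u \<otimes> v"
    unfolding u_def v_def by (rule pow_mult_distrib) (simp_all add: comm)
  have aat: "(a \<otimes> a \<otimes> t) [^] m = u \<otimes> u \<otimes> v"
  proof -
    have "a \<otimes> a \<otimes> t = t \<otimes> (a \<otimes> a)" using comm by (metis assms(2,5) m_assoc)
    then have "(a \<otimes> a \<otimes> t) [^] m = (a \<otimes> a) [^] m \<otimes> v"
      unfolding v_def by (intro pow_mult_distrib) simp_all
    also have "(a \<otimes> a) [^] m = u \<otimes> u"
      unfolding u_def by (rule pow_mult_distrib) simp_all
    finally show ?thesis .
  qed
  have "v = b \<otimes> (u \<otimes> v) \<otimes> inv b"
    unfolding at[symmetric] by (subst conj_nat_pow[symmetric]) (simp_all add: b v_def)
  then have q1: "square_sum v = square_sum (u \<otimes> v)"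
    using square_sum_conj[of "u \<otimes> v" b] uv core_mult by simp
  have "v = c \<otimes> (u \<otimes> u \<otimes> v) \<otimes> inv c"
    unfolding aat[symmetric] by (subst conj_nat_pow[symmetric]) (simp_all add: c v_def)
  then have q2: "square_sum v = square_sum (u \<otimes> u \<otimes> v)"
    using square_sum_conj[of "u \<otimes> u \<otimes> v" c] uv core_mult by simp
  define \<alpha> where "\<alpha> C = coset_character h C u" for C
  define \<tau> where "\<tau> C = coset_character h C v" for C
  have "(\<Sum>C \<in> rcosets H. (\<tau> C)\<^sup>2) = (\<Sum>C \<in> rcosets H. (\<alpha> C + \<tau> C)\<^sup>2)"
    using q1 uv unfolding square_sum_def \<alpha>_def \<tau>_def by (simp add: coset_character_mult)
  moreover have "(\<Sum>C \<in> rcosets H. (\<tau> C)\<^sup>2) = (\<Sum>C \<in> rcosets H. (\<alpha> C + \<alpha> C + \<tau> C)\<^sup>2)"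
    using q2 uv unfolding square_sum_def \<alpha>_def \<tau>_def by (simp add: coset_character_mult core_mult)
  moreover have "(\<Sum>C \<in> rcosets H. (\<alpha> C + \<tau> C)\<^sup>2)
      = (\<Sum>C \<in> rcosets H. (\<alpha> C)\<^sup>2) + (\<Sum>C \<in> rcosets H. (\<tau> C)\<^sup>2) + 2 * (\<Sum>C \<in> rcosets H. \<alpha> C * \<tau> C)"
    by (simp add: power2_sum sum.distrib sum_distrib_left mult.assoc)
  moreover have "(\<Sum>C \<in> rcosets H. (\<alpha> C + \<alpha> C + \<tau> C)\<^sup>2)
      = 4 * (\<Sum>C \<in> rcosets H. (\<alpha> C)\<^sup>2) + (\<Sum>C \<in> rcosets H. (\<tau> C)\<^sup>2) + 4 * (\<Sum>C \<in> rcosets H. \<alpha> C * \<tau> C)"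
  proof -
    have "(\<alpha> C + \<alpha> C + \<tau> C)\<^sup>2 = 4 * (\<alpha> C)\<^sup>2 + (\<tau> C)\<^sup>2 + 4 * (\<alpha> C * \<tau> C)" for C
      by (simp add: power2_eq_square algebra_simps)
    then show ?thesis by (simp add: sum.distrib sum_distrib_left)
  qed
  ultimately have "(\<Sum>C \<in> rcosets H. (\<alpha> C)\<^sup>2) = 0"
    by linarith
  then have "\<forall>C \<in> rcosets H. \<alpha> C = 0"
    using fin by (simp add: sum_nonneg_eq_0_iff)
  moreover have "H \<in> rcosets H"
    by (auto simp: RCOSETS_def coset_mult_one[OF H.subset] intro!: bexI[of _ \<one>])
  moreover have "\<alpha> H = h (\<one> \<otimes> u \<otimes> inv \<one>)"
    unfolding \<alpha>_def by (rule coset_character_eq) (use \<open>H \<in> rcosets H\<close> uv in auto)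
  ultimately show ?thesis
    by (simp add: u_def m_def)
qed

end

lemma commute_mult:
  assumes "g \<in> carrier G" "h \<in> carrier G" "k \<in> carrier G" "g \<otimes> h = h \<otimes> g" "g \<otimes> k = k \<otimes> g"
  shows "g \<otimes> (h \<otimes> k) = h \<otimes> k \<otimes> g"
  using assms by (metis m_assoc)

lemma commute_commutator:
  assumes "g \<in> carrier G" "h \<in> carrier G" "k \<in> carrier G" "g \<otimes> h = h \<otimes> g" "g \<otimes> k = k \<otimes> g"
  shows "g \<otimes> commutator G h k = commutator G h k \<otimes> g"
  unfolding commutator_def
  using assms commute_inv_left[of h g] commute_inv_left[of k g]
  by (intro commute_mult) simp_all

lemma nat_pow_commute:
  assumes "g \<in> carrier G" "h \<in> carrier G" "g \<otimes> h = h \<otimes> g"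
  shows "g [^] (n :: nat) \<otimes> h [^] (n :: nat) = h [^] n \<otimes> g [^] n"
proof -
  have "g [^] n \<otimes> h [^] n = (g \<otimes> h) [^] n"
    by (rule pow_mult_distrib[symmetric]) fact+
  also have "\<dots> = h [^] n \<otimes> g [^] n"
    unfolding assms(3) by (rule pow_mult_distrib) (fact assms(3)[symmetric] assms)+
  finally show ?thesis .
qed

text \<open>Some power \<open>A\<close> of \<open>a\<close> lies in the free kernel \<open>K\<close> by \<open>character_pow_eq_0\<close>.  The
  kernel also contains all commutators of powers of \<open>t\<close> and \<open>s\<close> that lie in \<open>H\<close>, and these commute with
  \<open>A\<close>.  Centralisers in a free group are abelian, so these commutators would commute with each
  other; two of them are assumed not to.\<close>

lemma not_virtually_free_by_cyclicI:
  assumes [simp]: "a \<in> carrier G" "b \<in> carrier G" "c \<in> carrier G" "t \<in> carrier G" "s \<in> carrier G"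
    and ta: "t \<otimes> a = a \<otimes> t" and sa: "s \<otimes> a = a \<otimes> s"
    and b: "b \<otimes> (a \<otimes> t) \<otimes> inv b = t" and c: "c \<otimes> (a \<otimes> a \<otimes> t) \<otimes> inv c = t"
    and a_order: "\<And>n :: nat. n > 0 \<Longrightarrow> a [^] n \<noteq> \<one>"
    and ts: "\<And>n :: nat. n > 0 \<Longrightarrow>
      commutator G (t [^] n) (s [^] n) \<otimes> commutator G (t [^] n \<otimes> t [^] n) (s [^] n)
      \<noteq> commutator G (t [^] n \<otimes> t [^] n) (s [^] n) \<otimes> commutator G (t [^] n) (s [^] n)"
  shows "\<not> virtually_free_by_cyclic G"
proof
  assume "virtually_free_by_cyclic G"
  then obtain H h where H: "subgroup H G" and fin: "finite (rcosets H)"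
    and epi: "h \<in> epi (G\<lparr>carrier := H\<rparr>) integer_group"
    and free: "is_free_group (G\<lparr>carrier := kernel (G\<lparr>carrier := H\<rparr>) integer_group h\<rparr>)"
    by (auto simp: virtually_free_by_cyclic_def free_by_cyclic_def)
  interpret H: subgroup H G by fact
  have h: "h \<in> hom (G\<lparr>carrier := H\<rparr>) integer_group" using epi by (simp add: epi_def)
  interpret GH: group "G\<lparr>carrier := H\<rparr>" by (rule subgroup_imp_group[OF H])
  interpret h: group_hom "G\<lparr>carrier := H\<rparr>" integer_group h
    using h by (simp add: group_hom_def group_hom_axioms_def GH.is_group)
  define K where "K = kernel (G\<lparr>carrier := H\<rparr>) integer_group h"
  have K: "g \<in> K \<longleftrightarrow> g \<in> H \<and> h g = 0" for g by (simp add: K_def kernel_def)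
  have "group (G\<lparr>carrier := H, carrier := K\<rparr>)"
    unfolding K_def by (rule GH.subgroup_imp_group[OF h.subgroup_kernel])
  then have group_K: "group (G\<lparr>carrier := K\<rparr>)" by simp
  define m :: nat where "m = fact (card (rcosets H))"
  have m: "m > 0" by (simp add: m_def)
  define A where "A = a [^] m"
  define T where "T = t [^] m"
  define S where "S = s [^] m"
  have G [simp]: "A \<in> carrier G" "T \<in> carrier G" "S \<in> carrier G" by (simp_all add: A_def T_def S_def)
  have mem: "A \<in> H" "T \<in> H" "S \<in> H"
    using finite_index_pow_mem[OF H fin] by (simp_all add: A_def T_def S_def m_def)
  have "h A = 0"
    unfolding A_def m_def by (rule character_pow_eq_0[OF H h fin _ _ _ _ ta b c]) simp_all
  then have AK: "A \<in> K" using mem by (simp add: K)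
  have commK: "commutator G g k \<in> K" if "g \<in> H" "k \<in> H" for g k
    unfolding K commutator_def using that
    by (simp add: character_mult[OF H h] character_inv[OF H h])
  have "A \<noteq> \<one>" using a_order[OF m] by (simp add: A_def)
  have AT: "A \<otimes> T = T \<otimes> A" and AS: "A \<otimes> S = S \<otimes> A"
    unfolding A_def T_def S_def by (simp_all add: nat_pow_commute ta sa)
  have ATT: "A \<otimes> (T \<otimes> T) = (T \<otimes> T) \<otimes> A" by (rule commute_mult) (simp_all add: AT)
  have "commutator G T S \<otimes> commutator G (T \<otimes> T) S = commutator G (T \<otimes> T) S \<otimes> commutator G T S"
    using is_free_group_centralizer_abelian[OF group_K free[folded K_def],
        of A "commutator G T S" "commutator G (T \<otimes> T) S"]
      AK commK mem \<open>A \<noteq> \<one>\<close> commute_commutator[of A T S] commute_commutator[of A "T \<otimes> T" S] AT AS ATT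
    by simp
  then show False using ts[OF m] by (simp add: T_def S_def)
qed

end

section \<open>Presentations containing a multiplication table\<close>

lemma (in group) int_pow_commute:
  assumes "g \<in> carrier G" "h \<in> carrier G" "g \<otimes> h = h \<otimes> g"
  shows "g [^] (n :: int) \<otimes> h = h \<otimes> g [^] n"
proof -
  have nat: "g [^] (k :: nat) \<otimes> h = h \<otimes> g [^] k" for k
    using assms group_commutes_pow by metis
  moreover have "inv (g [^] (k :: nat)) \<otimes> h = h \<otimes> inv (g [^] k)" for k
    by (rule commute_inv_left) (use assms nat in simp_all)
  ultimately show ?thesis by (cases "n < 0") (simp_all only: int_pow_def2 if_True if_False)
qed

text \<open>Vertex groups of the graph of groups, and the torus group, are reached from the plane by this map.\<close>

lemma (in group) commuting_pair_hom:
  assumes "g \<in> carrier G" "h \<in> carrier G" "g \<otimes> h = h \<otimes> g"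
  shows "(\<lambda>(m, n). g [^] m \<otimes> h [^] n) \<in> hom (integer_group \<times>\<times> integer_group) G"
proof (rule homI, goal_cases)
  case (1 p)
  then show ?case using assms by (cases p) simp
next
  case (2 p q)
  obtain m n m' n' where [simp]: "p = (m, n)" "q = (m', n')" by (cases p; cases q) auto
  have "h [^] n \<otimes> g [^] m' = g [^] m' \<otimes> h [^] n"
    using assms by (metis int_pow_commute int_pow_closed)
  then have "h [^] n \<otimes> (g [^] m' \<otimes> h [^] n') = g [^] m' \<otimes> (h [^] n \<otimes> h [^] n')"
    using assms by (metis int_pow_closed m_assoc)
  then show ?case using assms by (simp add: int_pow_mult m_assoc)
qed

lemma int_pow_integer_plane: "(k, l) [^]\<^bsub>integer_group \<times>\<times> integer_group\<^esub> (n :: int) = (n * k, n * l)"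
proof -
  have "(k, l) [^]\<^bsub>integer_group \<times>\<times> integer_group\<^esub> (i :: nat) = (int i * k, int i * l)" for i
    by (induction i) (simp_all add: nat_pow_def algebra_simps)
  then show ?thesis by (simp add: int_pow_def2)
qed

lemma (in presentation) multiplication_table_hom:
  assumes "group G" "\<iota> ` carrier G \<subseteq> X" "mult_relations \<iota> G \<subseteq> E"
  shows "(\<lambda>p. gen (\<iota> p)) \<in> hom G P"
proof (rule homI)
  show "gen (\<iota> p) \<in> carrier P" if "p \<in> carrier G" for p
    using that assms(2) by (intro gen_closed) auto
  show "gen (\<iota> (p \<otimes>\<^bsub>G\<^esub> q)) = gen (\<iota> p) \<otimes>\<^bsub>P\<^esub> gen (\<iota> q)" if pq: "p \<in> carrier G" "q \<in> carrier G" for p q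
  proof -
    interpret G: group G by fact
    have "([pos (\<iota> p), pos (\<iota> q)], [pos (\<iota> (p \<otimes>\<^bsub>G\<^esub> q))]) \<in> E"
      using pq assms(3) by (auto simp: mult_relations_def)
    from cls_relation[OF this] show ?thesis
      using gen_closed pq assms(2) by (simp add: word_value_Cons image_subset_iff)
  qed
qed

lemma word_value_mult_relations:
  assumes "group Q" "\<phi> \<in> hom G Q" "\<And>p. p \<in> carrier G \<Longrightarrow> f (\<iota> p) = \<phi> p"
    and "group G" "(u, v) \<in> mult_relations \<iota> G"
  shows "word_value Q f u = word_value Q f v"
proof -
  interpret Q: group Q by fact
  interpret G: group G by fact
  show ?thesis
    using assms(3,5) hom_mult[OF assms(2)] hom_in_carrier[OF assms(2)]
    by (auto simp: mult_relations_def word_value_Cons)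
qed

lemma (in group) conj_word_iff:
  assumes "t \<in> carrier G" "y \<in> carrier G" "z \<in> carrier G"
  shows "t \<otimes> (y \<otimes> inv t) = z \<longleftrightarrow> t \<otimes> y = z \<otimes> t"
  using assms by (simp add: inv_solve_right' flip: m_assoc)

section \<open>The Gersten group and the torus group\<close>

definition gersten_gen_elem :: "gersten_gen \<Rightarrow> gersten_gen word set" where
  "gersten_gen_elem y = word_class UNIV gersten_rels [pos y]"

definition torus_gen_elem :: "torus_gen \<Rightarrow> torus_gen word set" where
  "torus_gen_elem y = word_class UNIV torus_rels [pos y]"

text \<open>Short names for the generators: the prefix tells the group in which an element lives, \<open>g\<close> for
  the Gersten group, \<open>t\<close> for the torus group and, further below, \<open>a\<close> for the amalgam.\<close>

abbreviation "gA \<equiv> gersten_gen_elem gersten_gen.a"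
abbreviation "gB \<equiv> gersten_gen_elem gersten_gen.b"
abbreviation "gC \<equiv> gersten_gen_elem gersten_gen.c"
abbreviation "gT \<equiv> gersten_gen_elem gersten_gen.t"
abbreviation "tX \<equiv> torus_gen_elem torus_gen.x"
abbreviation "tS \<equiv> torus_gen_elem torus_gen.s"

interpretation gersten: presentation UNIV gersten_rels
  rewrites "presented_group UNIV gersten_rels \<equiv> gersten_group"
  by unfold_locales (simp_all add: gersten_group_def)

interpretation torus: presentation UNIV torus_rels
  rewrites "presented_group UNIV torus_rels \<equiv> torus_group"
  by unfold_locales (simp_all add: torus_group_def)

text \<open>The defining relations with the inverse of \<open>t\<close> moved to the other side, which makes them easy
  to check in concrete groups.\<close>

definition gersten_relations :: "('a, 'm) monoid_scheme \<Rightarrow> 'a \<Rightarrow> 'a \<Rightarrow> 'a \<Rightarrow> 'a \<Rightarrow> bool" where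
  "gersten_relations Q a b c t \<longleftrightarrow> {a, b, c, t} \<subseteq> carrier Q \<and>
     t \<otimes>\<^bsub>Q\<^esub> a = a \<otimes>\<^bsub>Q\<^esub> t \<and> t \<otimes>\<^bsub>Q\<^esub> b = b \<otimes>\<^bsub>Q\<^esub> a \<otimes>\<^bsub>Q\<^esub> t \<and>
     t \<otimes>\<^bsub>Q\<^esub> c = c \<otimes>\<^bsub>Q\<^esub> a \<otimes>\<^bsub>Q\<^esub> a \<otimes>\<^bsub>Q\<^esub> t"

lemma gersten_relations_gens: "gersten_relations gersten_group gA gB gC gT"
proof -
  have cl: "gersten_gen_elem y \<in> carrier gersten_group" for y
    unfolding gersten_gen_elem_def by (rule gersten.gen_closed) simp
  have rels: "word_value gersten_group gersten_gen_elem u = word_value gersten_group gersten_gen_elem v"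
    if "(u, v) \<in> gersten_rels" for u v
    using gersten.cls_relation[OF that] unfolding gersten_gen_elem_def .
  show ?thesis
    using rels[of "[pos gersten_gen.t, pos gersten_gen.a, neg gersten_gen.t]" "[pos gersten_gen.a]"]
      rels[of "[pos gersten_gen.t, pos gersten_gen.b, neg gersten_gen.t]" "[pos gersten_gen.b, pos gersten_gen.a]"]
      rels[of "[pos gersten_gen.t, pos gersten_gen.c, neg gersten_gen.t]"
        "[pos gersten_gen.c, pos gersten_gen.a, pos gersten_gen.a]"] cl
    by (simp add: gersten_rels_def word_value_Cons gersten_relations_def
        gersten.P.conj_word_iff gersten.P.m_assoc)
qed

lemma gersten_hom:
  assumes "group Q" "gersten_relations Q a b c t"
  obtains \<phi> where "\<phi> \<in> hom gersten_group Q" "\<phi> gA = a" "\<phi> gB = b" "\<phi> gC = c" "\<phi> gT = t"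
proof -
  interpret Q: group Q by fact
  let ?f = "case_gersten_gen a b c t"
  have cl: "a \<in> carrier Q" "b \<in> carrier Q" "c \<in> carrier Q" "t \<in> carrier Q"
    using assms(2) by (simp_all add: gersten_relations_def)
  have "?f \<in> UNIV \<rightarrow> carrier Q" using cl by (auto split: gersten_gen.split)
  moreover have "word_value Q ?f u = word_value Q ?f v" if "(u, v) \<in> gersten_rels" for u v
    using that assms(2) cl
    by (auto simp: gersten_rels_def word_value_Cons gersten_relations_def Q.conj_word_iff Q.m_assoc)
  ultimately obtain \<phi> where "\<phi> \<in> hom gersten_group Q"
    "\<And>y. y \<in> UNIV \<Longrightarrow> \<phi> (word_class UNIV gersten_rels [pos y]) = ?f y"
    using gersten.hom_from_generators[OF assms(1)] by metis
  then show thesis by (intro that[of \<phi>]) (simp_all add: gersten_gen_elem_def)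
qed

lemma gersten_hom_ext:
  assumes "group Q" "\<phi> \<in> hom gersten_group Q" "\<psi> \<in> hom gersten_group Q"
    and "\<phi> gA = \<psi> gA" "\<phi> gB = \<psi> gB" "\<phi> gC = \<psi> gC" "\<phi> gT = \<psi> gT"
    and "g \<in> carrier gersten_group"
  shows "\<phi> g = \<psi> g"
proof (rule gersten.hom_ext[OF assms(1-3) _ assms(8)])
  show "\<phi> (word_class UNIV gersten_rels [pos y]) = \<psi> (word_class UNIV gersten_rels [pos y])" for y
    using assms(4-7) by (cases y) (simp_all add: gersten_gen_elem_def)
qed

lemma torus_gen_closed: "torus_gen_elem y \<in> carrier torus_group"
  unfolding torus_gen_elem_def by (rule torus.gen_closed) simp

lemma torus_gens_commute: "tS \<otimes>\<^bsub>torus_group\<^esub> tX = tX \<otimes>\<^bsub>torus_group\<^esub> tS"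
proof -
  have "word_value torus_group torus_gen_elem [pos torus_gen.s, pos torus_gen.x, neg torus_gen.s]
      = word_value torus_group torus_gen_elem [pos torus_gen.x]"
    unfolding torus_gen_elem_def by (rule torus.cls_relation) (simp add: torus_rels_def)
  then show ?thesis
    by (simp add: word_value_Cons torus.P.conj_word_iff torus_gen_closed)
qed

lemma torus_hom:
  assumes "group Q" "x \<in> carrier Q" "s \<in> carrier Q" "s \<otimes>\<^bsub>Q\<^esub> x = x \<otimes>\<^bsub>Q\<^esub> s"
  obtains \<phi> where "\<phi> \<in> hom torus_group Q" "\<phi> tX = x" "\<phi> tS = s"
proof -
  interpret Q: group Q by fact
  let ?f = "case_torus_gen x s"
  have "?f \<in> UNIV \<rightarrow> carrier Q" using assms by (auto split: torus_gen.split)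
  moreover have "word_value Q ?f u = word_value Q ?f v" if "(u, v) \<in> torus_rels" for u v
    using that assms by (auto simp: torus_rels_def word_value_Cons Q.conj_word_iff)
  ultimately obtain \<phi> where "\<phi> \<in> hom torus_group Q"
    "\<And>y. y \<in> UNIV \<Longrightarrow> \<phi> (word_class UNIV torus_rels [pos y]) = ?f y"
    using torus.hom_from_generators[OF assms(1)] by metis
  then show thesis by (intro that[of \<phi>]) (simp_all add: torus_gen_elem_def)
qed

lemma torus_hom_ext:
  assumes "group Q" "\<phi> \<in> hom torus_group Q" "\<psi> \<in> hom torus_group Q"
    and "\<phi> tX = \<psi> tX" "\<phi> tS = \<psi> tS" "g \<in> carrier torus_group"
  shows "\<phi> g = \<psi> g"
proof (rule torus.hom_ext[OF assms(1-3) _ assms(6)])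
  show "\<phi> (word_class UNIV torus_rels [pos y]) = \<psi> (word_class UNIV torus_rels [pos y])" for y
    using assms(4,5) by (cases y) (simp_all add: torus_gen_elem_def)
qed

abbreviation plane :: "(int \<times> int) monoid" where
  "plane \<equiv> integer_group \<times>\<times> integer_group"

lemma group_plane: "group plane"
  by (intro DirProd_group) simp_all

lemma torus_group_iso_plane: "torus_group \<cong> plane"
proof -
  interpret plane: group plane by (rule group_plane)
  obtain \<phi> where \<phi>: "\<phi> \<in> hom torus_group plane" "\<phi> tX = (1, 0)" "\<phi> tS = (0, 1)"
    by (rule torus_hom[OF group_plane, of "(1, 0)" "(0, 1)"]) simp_all
  define \<psi> where "\<psi> = (\<lambda>(m, n). tX [^]\<^bsub>torus_group\<^esub> (m :: int) \<otimes>\<^bsub>torus_group\<^esub> tS [^]\<^bsub>torus_group\<^esub> (n :: int))"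
  have \<psi>: "\<psi> \<in> hom plane torus_group"
    unfolding \<psi>_def
    by (rule torus.P.commuting_pair_hom) (simp_all add: torus_gen_closed torus_gens_commute)
  show ?thesis
  proof (rule iso_by_inverse_homs[OF \<phi>(1) \<psi>])
    show "\<psi> (\<phi> g) = g" if "g \<in> carrier torus_group" for g
      by (rule torus_hom_ext[OF torus.P.is_group hom_compose[OF \<phi>(1) \<psi>, unfolded o_def] _ _ _ that, of "\<lambda>g. g"])
         (simp_all add: \<phi> \<psi>_def torus_gen_closed hom_def)
    show "\<phi> (\<psi> p) = p" for p
      using hom_mult[OF \<phi>(1)] hom_int_pow[OF \<phi>(1) _ torus.P.is_group group_plane] \<phi>(2,3)
      by (cases p) (simp add: \<psi>_def torus_gen_closed int_pow_integer_plane)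
  qed
qed

lemma torus_x_eq: "torus_x = tX" and gersten_a_eq: "gersten_a = gA"
  by (simp_all add: torus_x_def torus_gen_elem_def gersten_a_def gersten_gen_elem_def)

lemma torus_x_mon: "(\<lambda>n::int. torus_x [^]\<^bsub>torus_group\<^esub> n) \<in> mon integer_group torus_group"
proof -
  obtain \<phi> where \<phi>: "\<phi> \<in> hom torus_group plane" "\<phi> tX = (1, 0)" "\<phi> tS = (0, 1)"
    by (rule torus_hom[OF group_plane, of "(1, 0)" "(0, 1)"]) simp_all
  have "\<phi> (tX [^]\<^bsub>torus_group\<^esub> n) = (n, 0)" for n :: int
    using hom_int_pow[OF \<phi>(1) _ torus.P.is_group group_plane] \<phi>(2)
    by (simp add: torus_gen_closed int_pow_integer_plane)
  then have "inj (\<lambda>n::int. tX [^]\<^bsub>torus_group\<^esub> n)"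
    by (metis (no_types, lifting) injI prod.inject)
  then show ?thesis
    using torus.P.hom_integer_group_pow torus_gen_closed by (simp add: mon_def torus_x_eq)
qed

lemma gersten_gen_closed: "gersten_gen_elem y \<in> carrier gersten_group"
  unfolding gersten_gen_elem_def by (rule gersten.gen_closed) simp

lemma gersten_relations_heisenberg:
  "gersten_relations heisenberg (0, 0, 1) (0, 1, 0) (0, 2, 0) (1, 0, 0)"
  by (simp add: gersten_relations_def)

lemma heisenberg_centre_int_pow: "(0, 0, 1) [^]\<^bsub>heisenberg\<^esub> (n :: int) = (0, 0, n)"
proof -
  have "inv\<^bsub>heisenberg\<^esub> (0, 0, r) = (0, 0, - r)" for r
    by (rule group.inv_equality[OF group_heisenberg]) simp_all
  then show ?thesis by (simp add: int_pow_def2 heisenberg_centre_pow)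
qed

lemma gersten_a_mon: "(\<lambda>n::int. gersten_a [^]\<^bsub>gersten_group\<^esub> n) \<in> mon integer_group gersten_group"
proof -
  obtain \<phi> where \<phi>: "\<phi> \<in> hom gersten_group heisenberg" "\<phi> gA = (0, 0, 1)"
    using gersten_hom[OF group_heisenberg gersten_relations_heisenberg] by metis
  have "\<phi> (gA [^]\<^bsub>gersten_group\<^esub> n) = (0, 0, n)" for n :: int
    using hom_int_pow[OF \<phi>(1) _ gersten.P.is_group group_heisenberg] \<phi>(2)
    by (simp add: gersten_gen_closed heisenberg_centre_int_pow)
  then have "inj (\<lambda>n::int. gA [^]\<^bsub>gersten_group\<^esub> n)"
    by (metis (no_types, lifting) injI prod.inject)
  then show ?thesis
    using gersten.P.hom_integer_group_pow gersten_gen_closed by (simp add: mon_def gersten_a_eq)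
qed

section \<open>The amalgam as a group on five generators\<close>

text \<open>The presentation that defines the amalgam, written out so that it can be used as an instance of
  \<^locale>\<open>presentation\<close>.\<close>

definition amalgam_letters :: "(gersten_gen word set + torus_gen word set) set" where
  "amalgam_letters = Inl ` carrier gersten_group \<union> Inr ` carrier torus_group"

definition amalgam_rels ::
  "((gersten_gen word set + torus_gen word set) word \<times> (gersten_gen word set + torus_gen word set) word) set" where
  "amalgam_rels = mult_relations Inl gersten_group \<union> mult_relations Inr torus_group \<union>
     {([pos (Inl (gersten_a [^]\<^bsub>gersten_group\<^esub> n))], [pos (Inr (torus_x [^]\<^bsub>torus_group\<^esub> n))]) | n :: int. True}"

lemma gersten_amalgam_presentation: "presented_group amalgam_letters amalgam_rels = gersten_amalgam"
  by (simp add: gersten_amalgam_def amalgamated_product_def amalgam_letters_def amalgam_rels_def)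

interpretation amalgam: presentation amalgam_letters amalgam_rels
  rewrites "presented_group amalgam_letters amalgam_rels \<equiv> gersten_amalgam"
proof -
  show "presentation amalgam_letters amalgam_rels"
    by unfold_locales
       (auto simp: amalgam_letters_def amalgam_rels_def mult_relations_def
          gersten_a_eq torus_x_eq gersten_gen_closed torus_gen_closed)
  show "presented_group amalgam_letters amalgam_rels \<equiv> gersten_amalgam"
    by (simp only: gersten_amalgam_presentation)
qed

definition from_gersten :: "gersten_gen word set \<Rightarrow> (gersten_gen word set + torus_gen word set) word set" where
  "from_gersten p = word_class amalgam_letters amalgam_rels [pos (Inl p)]"

definition from_torus :: "torus_gen word set \<Rightarrow> (gersten_gen word set + torus_gen word set) word set" where
  "from_torus p = word_class amalgam_letters amalgam_rels [pos (Inr p)]"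

lemma from_gersten_hom: "from_gersten \<in> hom gersten_group gersten_amalgam"
  unfolding from_gersten_def
  by (rule amalgam.multiplication_table_hom[OF gersten.P.is_group])
     (auto simp: amalgam_letters_def amalgam_rels_def)

lemma from_torus_hom: "from_torus \<in> hom torus_group gersten_amalgam"
  unfolding from_torus_def
  by (rule amalgam.multiplication_table_hom[OF torus.P.is_group])
     (auto simp: amalgam_letters_def amalgam_rels_def)

lemma from_torus_x: "from_torus tX = from_gersten gA"
proof -
  have "([pos (Inl (gersten_a [^]\<^bsub>gersten_group\<^esub> (1::int)))], [pos (Inr (torus_x [^]\<^bsub>torus_group\<^esub> (1::int)))]) \<in> amalgam_rels"
    unfolding amalgam_rels_def by blast
  from amalgam.cls_relation[OF this] show ?thesis
    using hom_in_carrier[OF from_gersten_hom gersten_gen_closed] hom_in_carrier[OF from_torus_hom torus_gen_closed]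
    by (simp add: word_value_Cons gersten_a_eq torus_x_eq gersten_gen_closed torus_gen_closed
        flip: from_gersten_def from_torus_def)
qed

abbreviation "aA \<equiv> from_gersten gA"
abbreviation "aB \<equiv> from_gersten gB"
abbreviation "aC \<equiv> from_gersten gC"
abbreviation "aT \<equiv> from_gersten gT"
abbreviation "aS \<equiv> from_torus tS"

definition amalgam_relations :: "('a, 'm) monoid_scheme \<Rightarrow> 'a \<Rightarrow> 'a \<Rightarrow> 'a \<Rightarrow> 'a \<Rightarrow> 'a \<Rightarrow> bool" where
  "amalgam_relations Q a b c t s \<longleftrightarrow>
     gersten_relations Q a b c t \<and> s \<in> carrier Q \<and> s \<otimes>\<^bsub>Q\<^esub> a = a \<otimes>\<^bsub>Q\<^esub> s"

lemma gersten_relations_image: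
  assumes "\<phi> \<in> hom G Q" "gersten_relations G a b c t" "group G"
  shows "gersten_relations Q (\<phi> a) (\<phi> b) (\<phi> c) (\<phi> t)"
proof -
  interpret G: group G by fact
  have cl: "a \<in> carrier G" "b \<in> carrier G" "c \<in> carrier G" "t \<in> carrier G"
    using assms(2) by (simp_all add: gersten_relations_def)
  then show ?thesis
    using assms(2) hom_in_carrier[OF assms(1)] hom_mult[OF assms(1), symmetric]
    by (simp add: gersten_relations_def)
qed

lemma amalgam_relations_gens: "amalgam_relations gersten_amalgam aA aB aC aT aS"
proof -
  have "aS \<otimes>\<^bsub>gersten_amalgam\<^esub> from_torus tX = from_torus tX \<otimes>\<^bsub>gersten_amalgam\<^esub> aS"
    using torus_gens_commute by (simp add: torus_gen_closed flip: hom_mult[OF from_torus_hom])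
  then show ?thesis
    using gersten_relations_image[OF from_gersten_hom gersten_relations_gens gersten.P.is_group]
      hom_in_carrier[OF from_torus_hom torus_gen_closed]
    by (simp add: amalgam_relations_def from_torus_x)
qed

text \<open>The homomorphisms out of the two factors are determined by \<open>a, b, c, t\<close> and by \<open>a, s\<close>; they
  agree on the amalgamated cyclic subgroup because both take its generator to \<open>a\<close>.  This reduces the amalgam,
  presented by all elements of its factors, to a group on five generators.\<close>

lemma amalgam_hom:
  assumes "group Q" and rel: "amalgam_relations Q a b c t s"
  obtains \<phi> where "\<phi> \<in> hom gersten_amalgam Q"
    "\<phi> aA = a" "\<phi> aB = b" "\<phi> aC = c" "\<phi> aT = t" "\<phi> aS = s"
proof -
  interpret Q: group Q by fact
  obtain \<alpha> where \<alpha>: "\<alpha> \<in> hom gersten_group Q" "\<alpha> gA = a" "\<alpha> gB = b" "\<alpha> gC = c" "\<alpha> gT = t"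
    using rel gersten_hom[OF assms(1)] by (metis amalgam_relations_def)
  have "a \<in> carrier Q" using rel by (simp add: amalgam_relations_def gersten_relations_def)
  then obtain \<beta> where \<beta>: "\<beta> \<in> hom torus_group Q" "\<beta> tX = a" "\<beta> tS = s"
    using rel torus_hom[OF assms(1), of a s] by (metis amalgam_relations_def)
  let ?f = "case_sum \<alpha> \<beta>"
  have "?f \<in> amalgam_letters \<rightarrow> carrier Q"
    using hom_in_carrier[OF \<alpha>(1)] hom_in_carrier[OF \<beta>(1)] by (auto simp: amalgam_letters_def)
  moreover have "word_value Q ?f u = word_value Q ?f v" if uv: "(u, v) \<in> amalgam_rels" for u v
  proof -
    consider "(u, v) \<in> mult_relations Inl gersten_group" | "(u, v) \<in> mult_relations Inr torus_group"
      | n :: int where "u = [pos (Inl (gersten_a [^]\<^bsub>gersten_group\<^esub> n))]" "v = [pos (Inr (torus_x [^]\<^bsub>torus_group\<^esub> n))]"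
      using uv unfolding amalgam_rels_def by blast
    then show ?thesis
    proof cases
      case 1
      then show ?thesis
        by (rule word_value_mult_relations[OF assms(1) \<alpha>(1) _ gersten.P.is_group, rotated]) simp
    next
      case 2
      then show ?thesis
        by (rule word_value_mult_relations[OF assms(1) \<beta>(1) _ torus.P.is_group, rotated]) simp
    next
      case 3
      then show ?thesis
        using hom_int_pow[OF \<alpha>(1) gersten_gen_closed gersten.P.is_group assms(1)]
          hom_int_pow[OF \<beta>(1) torus_gen_closed torus.P.is_group assms(1)] \<alpha>(2) \<beta>(2)
        by (simp add: word_value_Cons gersten_a_eq torus_x_eq)
    qed
  qed
  ultimately obtain \<phi> where \<phi>: "\<phi> \<in> hom gersten_amalgam Q"
    "\<And>y. y \<in> amalgam_letters \<Longrightarrow> \<phi> (word_class amalgam_letters amalgam_rels [pos y]) = ?f y"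
    using amalgam.hom_from_generators[OF assms(1)] by metis
  have "\<phi> (from_gersten p) = \<alpha> p" if "p \<in> carrier gersten_group" for p
    using \<phi>(2)[of "Inl p"] that by (simp add: from_gersten_def amalgam_letters_def)
  moreover have "\<phi> (from_torus p) = \<beta> p" if "p \<in> carrier torus_group" for p
    using \<phi>(2)[of "Inr p"] that by (simp add: from_torus_def amalgam_letters_def image_iff)
  ultimately show thesis
    using \<phi>(1) \<alpha> \<beta> by (intro that[of \<phi>]) (simp_all add: gersten_gen_closed torus_gen_closed)
qed

lemma amalgam_hom_ext:
  assumes "group Q" and hom: "\<phi> \<in> hom gersten_amalgam Q" "\<psi> \<in> hom gersten_amalgam Q"
    and eq: "\<phi> aA = \<psi> aA" "\<phi> aB = \<psi> aB" "\<phi> aC = \<psi> aC" "\<phi> aT = \<psi> aT" "\<phi> aS = \<psi> aS"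
    and g: "g \<in> carrier gersten_amalgam"
  shows "\<phi> g = \<psi> g"
proof (rule amalgam.hom_ext[OF assms(1) hom _ g])
  have gersten: "\<phi> (from_gersten p) = \<psi> (from_gersten p)" if "p \<in> carrier gersten_group" for p
    by (rule gersten_hom_ext[OF assms(1) hom_compose[OF from_gersten_hom hom(1), unfolded o_def]
          hom_compose[OF from_gersten_hom hom(2), unfolded o_def] _ _ _ _ that]) (use eq in simp_all)
  have torus: "\<phi> (from_torus p) = \<psi> (from_torus p)" if "p \<in> carrier torus_group" for p
    by (rule torus_hom_ext[OF assms(1) hom_compose[OF from_torus_hom hom(1), unfolded o_def]
          hom_compose[OF from_torus_hom hom(2), unfolded o_def] _ _ that]) (use eq from_torus_x in simp_all)
  show "\<phi> (word_class amalgam_letters amalgam_rels [pos y]) = \<psi> (word_class amalgam_letters amalgam_rels [pos y])"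
    if "y \<in> amalgam_letters" for y
    using that gersten torus by (auto simp: amalgam_letters_def from_gersten_def from_torus_def)
qed

section \<open>The amalgam is not virtually free-by-cyclic\<close>

lemma hom_commutator:
  assumes "group G" "group Q" "\<phi> \<in> hom G Q" "g \<in> carrier G" "h \<in> carrier G"
  shows "\<phi> (commutator G g h) = commutator Q (\<phi> g) (\<phi> h)"
proof -
  interpret group_hom G Q \<phi> using assms by (simp add: group_hom_def group_hom_axioms_def)
  show ?thesis using assms(4,5) by (simp add: commutator_def)
qed

lemma amalgam_relations_closed:
  assumes "amalgam_relations Q a b c t s"
  shows "a \<in> carrier Q" "b \<in> carrier Q" "c \<in> carrier Q" "t \<in> carrier Q" "s \<in> carrier Q"
  using assms by (simp_all add: amalgam_relations_def gersten_relations_def)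

text \<open>The obstruction applies with \<open>b\<close> and \<open>c\<close> as the conjugating elements: the relation \<open>t b = b a t\<close>
  says \<open>b (a t) b\<inverse> = t\<close>, and similarly for \<open>c\<close> and \<open>a\<^sup>2 t\<close>.  The two conditions on powers are checked in the
  Heisenberg group and in the special linear group.\<close>

lemma gersten_amalgam_not_virtually_free_by_cyclic: "\<not> virtually_free_by_cyclic gersten_amalgam"
proof -
  let ?G = gersten_amalgam
  note rel = amalgam_relations_gens
  note cl [simp] = amalgam_relations_closed[OF rel]
  show ?thesis
  proof (rule amalgam.P.not_virtually_free_by_cyclicI[of aA aB aC aT aS])
    show "aT \<otimes>\<^bsub>?G\<^esub> aA = aA \<otimes>\<^bsub>?G\<^esub> aT" "aS \<otimes>\<^bsub>?G\<^esub> aA = aA \<otimes>\<^bsub>?G\<^esub> aS"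
      using rel by (simp_all add: amalgam_relations_def gersten_relations_def)
    have tb: "aT \<otimes>\<^bsub>?G\<^esub> aB = aB \<otimes>\<^bsub>?G\<^esub> aA \<otimes>\<^bsub>?G\<^esub> aT"
      and tc: "aT \<otimes>\<^bsub>?G\<^esub> aC = aC \<otimes>\<^bsub>?G\<^esub> aA \<otimes>\<^bsub>?G\<^esub> aA \<otimes>\<^bsub>?G\<^esub> aT"
      using rel by (simp_all add: amalgam_relations_def gersten_relations_def)
    show "aB \<otimes>\<^bsub>?G\<^esub> (aA \<otimes>\<^bsub>?G\<^esub> aT) \<otimes>\<^bsub>?G\<^esub> inv\<^bsub>?G\<^esub> aB = aT"
      using tb by (intro amalgam.P.inv_solve_right'[THEN iffD2]) (simp_all add: amalgam.P.m_assoc)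
    show "aC \<otimes>\<^bsub>?G\<^esub> (aA \<otimes>\<^bsub>?G\<^esub> aA \<otimes>\<^bsub>?G\<^esub> aT) \<otimes>\<^bsub>?G\<^esub> inv\<^bsub>?G\<^esub> aC = aT"
      using tc by (intro amalgam.P.inv_solve_right'[THEN iffD2]) (simp_all add: amalgam.P.m_assoc)
  next
    fix n :: nat
    assume n: "n > 0"
    have "amalgam_relations heisenberg (0, 0, 1) (0, 1, 0) (0, 2, 0) (1, 0, 0) (0, 0, 0)"
      by (simp add: amalgam_relations_def gersten_relations_heisenberg)
    then obtain \<phi> where \<phi>: "\<phi> \<in> hom ?G heisenberg" "\<phi> aA = (0, 0, 1)"
      using amalgam_hom[OF group_heisenberg] by metis
    interpret \<phi>: group_hom ?G heisenberg \<phi>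
      using \<phi>(1) by (simp add: group_hom_def group_hom_axioms_def amalgam.P.is_group)
    have "\<phi> (aA [^]\<^bsub>?G\<^esub> n) = (0, 0, int n)"
      by (simp add: \<phi>.hom_nat_pow \<phi>(2) heisenberg_centre_pow)
    then show "aA [^]\<^bsub>?G\<^esub> n \<noteq> \<one>\<^bsub>?G\<^esub>" using n \<phi>.hom_one by auto
  next
    fix n :: nat
    assume n: "n > 0"
    have "amalgam_relations SL2Z (1, 0, 0, 1) (1, 0, 0, 1) (1, 0, 0, 1) (1, 1, 0, 1) (1, 0, 1, 1)"
      by (simp add: amalgam_relations_def gersten_relations_def)
    then obtain \<phi> where \<phi>: "\<phi> \<in> hom ?G SL2Z" "\<phi> aT = (1, 1, 0, 1)" "\<phi> aS = (1, 0, 1, 1)"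
      using amalgam_hom[OF group_SL2Z] by metis
    interpret \<phi>: group_hom ?G SL2Z \<phi>
      using \<phi>(1) by (simp add: group_hom_def group_hom_axioms_def amalgam.P.is_group)
    let ?T = "aT [^]\<^bsub>?G\<^esub> n" and ?S = "aS [^]\<^bsub>?G\<^esub> n"
    have comm_closed: "commutator ?G g h \<in> carrier ?G" if "g \<in> carrier ?G" "h \<in> carrier ?G" for g h
      using that by (simp add: commutator_def)
    show "commutator ?G ?T ?S \<otimes>\<^bsub>?G\<^esub> commutator ?G (?T \<otimes>\<^bsub>?G\<^esub> ?T) ?S
        \<noteq> commutator ?G (?T \<otimes>\<^bsub>?G\<^esub> ?T) ?S \<otimes>\<^bsub>?G\<^esub> commutator ?G ?T ?S"
    proof
      assume "commutator ?G ?T ?S \<otimes>\<^bsub>?G\<^esub> commutator ?G (?T \<otimes>\<^bsub>?G\<^esub> ?T) ?S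
        = commutator ?G (?T \<otimes>\<^bsub>?G\<^esub> ?T) ?S \<otimes>\<^bsub>?G\<^esub> commutator ?G ?T ?S"
      then have "\<phi> (commutator ?G ?T ?S \<otimes>\<^bsub>?G\<^esub> commutator ?G (?T \<otimes>\<^bsub>?G\<^esub> ?T) ?S)
        = \<phi> (commutator ?G (?T \<otimes>\<^bsub>?G\<^esub> ?T) ?S \<otimes>\<^bsub>?G\<^esub> commutator ?G ?T ?S)" by simp
      then show False
        using SL2Z_commutators_not_commute[OF n]
        by (simp add: comm_closed hom_commutator[OF amalgam.P.is_group group_SL2Z \<phi>(1)]
            \<phi>.hom_nat_pow \<phi>(2,3) del: SL2Z_simps)
    qed
  qed simp_all
qed

section \<open>The amalgam is tubular\<close>

text \<open>Vertex \<open>0\<close> carries \<open>\<langle>a, t\<rangle>\<close> and vertex \<open>1\<close> carries \<open>\<langle>x, s\<rangle>\<close>.  The loops \<open>0\<close> and \<open>1\<close> have the stable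
  letters \<open>b\<close> and \<open>c\<close>; arc \<open>2\<close> realises the amalgamation and is the maximal subtree.\<close>

definition tubular_graph :: "(nat, nat) pre_digraph" where
  "tubular_graph = \<lparr>verts = {0, 1}, arcs = {0, 1, 2}, tail = (\<lambda>_. 0), head = (\<lambda>e. if e = 2 then 1 else 0)\<rparr>"

definition tubular_tree :: "(nat, nat) pre_digraph" where
  "tubular_tree = tubular_graph\<lparr>arcs := {2}\<rparr>"

text \<open>A pair \<open>(m, n)\<close> stands for \<open>a\<^sup>m t\<^sup>n\<close> at vertex \<open>0\<close> and for \<open>x\<^sup>m s\<^sup>n\<close> at vertex \<open>1\<close>.  Read as HNN
  relations, the last two Gersten relations are \<open>b (a t) b\<inverse> = t\<close> and \<open>c (a\<^sup>2 t) c\<inverse> = t\<close>; on the two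
  loops the head maps send the generator of the edge group to \<open>a t\<close> and \<open>a\<^sup>2 t\<close>, the tail maps to \<open>t\<close>.\<close>

definition tubular_gog :: "(nat, nat, int \<times> int, int) graph_of_groups" where
  "tubular_gog = \<lparr>base = tubular_graph, vertex_group = (\<lambda>_. plane), edge_group = (\<lambda>_. integer_group),
     tail_map = (\<lambda>e n. if e = 2 then (n, 0) else (0, n)),
     head_map = (\<lambda>e n. if e = 0 then (n, n) else if e = 1 then (2 * n, n) else (n, 0))\<rparr>"

lemma wf_tubular_graph: "fin_digraph tubular_graph"
  by unfold_locales (auto simp: tubular_graph_def)

lemma connected_if_arc:
  assumes "verts \<Gamma> = {0, 1 :: nat}" "2 \<in> arcs \<Gamma>" "tail \<Gamma> (2 :: nat) = 0" "head \<Gamma> 2 = 1"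
  shows "connected \<Gamma>"
proof -
  let ?S = "with_proj (mk_symmetric \<Gamma>)"
  have "{(tail \<Gamma> 2, head \<Gamma> 2), (head \<Gamma> 2, tail \<Gamma> 2)} \<subseteq> arcs_ends ?S"
    unfolding with_proj_simps parcs_mk_symmetric using assms(2) by blast
  then have arcs: "(0, 1) \<in> arcs_ends ?S" "(1, 0) \<in> arcs_ends ?S"
    using assms(3,4) by simp_all
  have refl: "u \<rightarrow>\<^sup>*\<^bsub>?S\<^esub> u" if "u \<in> {0, 1}" for u
    using that assms(1) by (simp add: reachable_def)
  have step: "u \<rightarrow>\<^sup>*\<^bsub>?S\<^esub> v" if "u \<in> {0, 1}" "v \<in> {0, 1}" "(u, v) \<in> arcs_ends ?S" for u v
    using rtrancl_on_into_rtrancl_on[OF refl[OF that(1), unfolded reachable_def] that(3)] that(2) assms(1)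
    by (simp add: reachable_def)
  have "u \<rightarrow>\<^sup>*\<^bsub>?S\<^esub> v" if "u \<in> {0, 1}" "v \<in> {0, 1}" for u v
    using that refl step[of 0 1] step[of 1 0] arcs by auto
  then show ?thesis
    using assms(1) by (simp add: connected_def strongly_connected_def)
qed

lemma connected_tubular_graph: "connected tubular_graph"
  by (rule connected_if_arc) (simp_all add: tubular_graph_def)

lemma maximal_subtree_tubular: "maximal_subtree tubular_tree tubular_graph"
proof -
  have "connected tubular_tree"
    by (rule connected_if_arc) (simp_all add: tubular_graph_def tubular_tree_def)
  moreover have "spanning tubular_tree tubular_graph"
    unfolding spanning_def subgraph_def compatible_def wf_digraph_def
    by (auto simp: tubular_graph_def tubular_tree_def)
  moreover have "\<not> connected (tubular_tree\<lparr>arcs := {}\<rparr>)"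
  proof
    let ?S = "with_proj (mk_symmetric (tubular_tree\<lparr>arcs := {}\<rparr>))"
    assume "connected (tubular_tree\<lparr>arcs := {}\<rparr>)"
    then have "0 \<rightarrow>\<^sup>*\<^bsub>?S\<^esub> 1"
      by (auto simp: connected_def strongly_connected_def tubular_tree_def tubular_graph_def)
    moreover have "arcs_ends ?S = {}"
      by (simp add: parcs_mk_symmetric)
    ultimately show False
      unfolding reachable_def by (auto elim: rtrancl_on.cases)
  qed
  ultimately show ?thesis
    by (auto simp: maximal_subtree_def tubular_tree_def)
qed

lemma tubular_gog_is_graph_of_groups: "is_graph_of_groups tubular_gog"
proof -
  have "wf_digraph tubular_graph" using wf_tubular_graph by (simp add: fin_digraph_def)
  then show ?thesis
    using connected_tubular_graph
    by (auto simp: is_graph_of_groups_def tubular_gog_def group_plane mon_def inj_on_def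
        intro!: homI)
qed

section \<open>The fundamental group of the graph of groups\<close>

text \<open>The generators and relations of the fundamental group in the case at hand: every arc has tail \<open>0\<close>.\<close>

definition bass_serre_letters :: "(nat \<times> int \<times> int + nat) set" where
  "bass_serre_letters = {Inl (v, p) | v p. v \<in> {0, 1}} \<union> Inr ` {0, 1, 2}"

definition bass_serre_rels :: "((nat \<times> int \<times> int + nat) word \<times> (nat \<times> int \<times> int + nat) word) set" where
  "bass_serre_rels = (\<Union>v \<in> {0, 1}. mult_relations (\<lambda>p. Inl (v, p)) plane) \<union>
     {([pos (Inr e), pos (Inl (head tubular_graph e, head_map tubular_gog e n)), neg (Inr e)],
       [pos (Inl (0, tail_map tubular_gog e n))]) | e n. e \<in> {0, 1, 2}} \<union>
     {([pos (Inr 2)], [])}"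

lemma tubular_gog_maps:
  "head tubular_graph e = (if e = 2 then 1 else 0)"
  "tail_map tubular_gog e n = (if e = 2 then (n, 0) else (0, n))"
  "head_map tubular_gog e n = (if e = 0 then (n, n) else if e = 1 then (2 * n, n) else (n, 0))"
  by (simp_all add: tubular_graph_def tubular_gog_def)

abbreviation bass_serre_group where
  "bass_serre_group \<equiv> fundamental_group tubular_gog tubular_tree"

lemma bass_serre_presentation: "presented_group bass_serre_letters bass_serre_rels = bass_serre_group"
proof -
  have "tail tubular_graph e = 0" for e by (simp add: tubular_graph_def)
  then show ?thesis
    unfolding fundamental_group_def bass_serre_letters_def bass_serre_rels_def
    by (simp add: tubular_gog_def) (simp add: tubular_graph_def tubular_tree_def)
qed

interpretation bass_serre: presentation bass_serre_letters bass_serre_rels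
  rewrites "presented_group bass_serre_letters bass_serre_rels \<equiv> bass_serre_group"
proof -
  show "presentation bass_serre_letters bass_serre_rels"
    by unfold_locales
       (auto simp: bass_serre_letters_def bass_serre_rels_def mult_relations_def tubular_graph_def)
  show "presented_group bass_serre_letters bass_serre_rels \<equiv> bass_serre_group"
    by (simp only: bass_serre_presentation)
qed

definition vertex_elem :: "nat \<Rightarrow> int \<times> int \<Rightarrow> (nat \<times> int \<times> int + nat) word set" where
  "vertex_elem v p = word_class bass_serre_letters bass_serre_rels [pos (Inl (v, p))]"

definition edge_elem :: "nat \<Rightarrow> (nat \<times> int \<times> int + nat) word set" where
  "edge_elem e = word_class bass_serre_letters bass_serre_rels [pos (Inr e)]"

lemma vertex_elem_hom: "v \<in> {0, 1} \<Longrightarrow> vertex_elem v \<in> hom plane bass_serre_group"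
  unfolding vertex_elem_def
  by (rule bass_serre.multiplication_table_hom[OF group_plane])
     (auto simp: bass_serre_letters_def bass_serre_rels_def)

lemma edge_elem_closed: "e \<in> {0, 1, 2} \<Longrightarrow> edge_elem e \<in> carrier bass_serre_group"
  unfolding edge_elem_def by (rule bass_serre.gen_closed) (auto simp: bass_serre_letters_def)

lemma edge_elem_tree: "edge_elem 2 = \<one>\<^bsub>bass_serre_group\<^esub>"
proof -
  have "([pos (Inr 2)], []) \<in> bass_serre_rels" by (simp add: bass_serre_rels_def)
  from bass_serre.cls_relation[OF this] show ?thesis
    using edge_elem_closed[of 2] by (simp add: word_value_Cons flip: edge_elem_def)
qed

lemma edge_elem_relation:
  assumes "e \<in> {0, 1, 2}"
  shows "edge_elem e \<otimes>\<^bsub>bass_serre_group\<^esub> vertex_elem (head tubular_graph e) (head_map tubular_gog e n)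
    = vertex_elem 0 (tail_map tubular_gog e n) \<otimes>\<^bsub>bass_serre_group\<^esub> edge_elem e"
proof -
  have head: "head tubular_graph e \<in> {0, 1}" by (simp add: tubular_graph_def)
  have "([pos (Inr e), pos (Inl (head tubular_graph e, head_map tubular_gog e n)), neg (Inr e)],
       [pos (Inl (0, tail_map tubular_gog e n))]) \<in> bass_serre_rels"
    using assms unfolding bass_serre_rels_def by blast
  from bass_serre.cls_relation[OF this] show ?thesis
    using edge_elem_closed[OF assms] hom_in_carrier[OF vertex_elem_hom[OF head]]
      hom_in_carrier[OF vertex_elem_hom[of 0]]
    by (simp add: word_value_Cons bass_serre.P.conj_word_iff flip: edge_elem_def vertex_elem_def)
qed

lemma amalgam_relations_bass_serre:
  "amalgam_relations bass_serre_group
     (vertex_elem 0 (1, 0)) (edge_elem 0) (edge_elem 1) (vertex_elem 0 (0, 1)) (vertex_elem 1 (0, 1))"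
  and vertex_elem_amalgamated: "vertex_elem 1 (1, 0) = vertex_elem 0 (1, 0)"
proof -
  let ?B = bass_serre_group
  have v0: "vertex_elem 0 p \<in> carrier ?B" and v1: "vertex_elem 1 p \<in> carrier ?B" for p
    using hom_in_carrier[OF vertex_elem_hom] by simp_all
  have e: "edge_elem 0 \<in> carrier ?B" "edge_elem 1 \<in> carrier ?B"
    by (simp_all add: edge_elem_closed)
  have mult: "vertex_elem v p \<otimes>\<^bsub>?B\<^esub> vertex_elem v q = vertex_elem v (p \<otimes>\<^bsub>plane\<^esub> q)" if "v \<in> {0, 1}" for v p q
    using hom_mult[OF vertex_elem_hom[OF that], of p q] by simp
  show amalg: "vertex_elem 1 (1, 0) = vertex_elem 0 (1, 0)"
    using edge_elem_relation[of 2 1] v0 v1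
    by (simp add: edge_elem_tree tubular_gog_maps)
  have "edge_elem 0 \<otimes>\<^bsub>?B\<^esub> vertex_elem 0 (1, 1) = vertex_elem 0 (0, 1) \<otimes>\<^bsub>?B\<^esub> edge_elem 0"
    "edge_elem 1 \<otimes>\<^bsub>?B\<^esub> vertex_elem 0 (2, 1) = vertex_elem 0 (0, 1) \<otimes>\<^bsub>?B\<^esub> edge_elem 1"
    using edge_elem_relation[of 0 1] edge_elem_relation[of 1 1]
    by (simp_all add: tubular_gog_maps)
  moreover have "vertex_elem 1 (0, 1) \<otimes>\<^bsub>?B\<^esub> vertex_elem 0 (1, 0) = vertex_elem 0 (1, 0) \<otimes>\<^bsub>?B\<^esub> vertex_elem 1 (0, 1)"
    unfolding amalg[symmetric] by (simp add: mult)
  ultimately show "amalgam_relations ?B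
     (vertex_elem 0 (1, 0)) (edge_elem 0) (edge_elem 1) (vertex_elem 0 (0, 1)) (vertex_elem 1 (0, 1))"
    unfolding amalgam_relations_def gersten_relations_def
    using v0 v1 e by (simp add: bass_serre.P.m_assoc mult)
qed

context group
begin

lemma conj_int_pow:
  assumes "r \<in> carrier G" "z \<in> carrier G"
  shows "(r \<otimes> z \<otimes> inv r) [^] (n :: int) = r \<otimes> z [^] n \<otimes> inv r"
proof -
  have "(\<lambda>z. r \<otimes> z \<otimes> inv r) \<in> hom G G"
    using assms(1) by (intro homI) (simp_all add: m_assoc inv_cancel)
  from hom_int_pow[OF this assms(2) is_group is_group] show ?thesis by simp
qed

text \<open>Only the edge relation for the generator of the edge group is given; the relations for its powers
  follow because conjugation by \<open>b\<close> is a homomorphism.\<close>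

lemma stable_letter_relation:
  assumes "a \<in> carrier G" "t \<in> carrier G" "b \<in> carrier G" "t \<otimes> a = a \<otimes> t"
    and "t \<otimes> b = b \<otimes> (a [^] (k :: int) \<otimes> t)"
  shows "b \<otimes> (a [^] (k * n) \<otimes> t [^] n) = t [^] n \<otimes> b"
proof -
  have "a [^] k \<otimes> t = t \<otimes> a [^] k" using assms by (intro int_pow_commute) simp_all
  then have "(a [^] k \<otimes> t) [^] n = (a [^] k) [^] n \<otimes> t [^] n"
    using assms by (intro int_pow_mult_distrib) simp_all
  then have "(a [^] k \<otimes> t) [^] n = a [^] (k * n) \<otimes> t [^] n"
    using assms(1) by (simp add: int_pow_pow)
  moreover have "b \<otimes> (a [^] k \<otimes> t) \<otimes> inv b = t"
    using assms by (simp add: inv_solve_right' flip: assms(5))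
  then have "t [^] n = b \<otimes> (a [^] k \<otimes> t) [^] n \<otimes> inv b"
    using assms conj_int_pow[of b "a [^] k \<otimes> t" n] by simp
  ultimately show ?thesis
    using assms by (simp add: m_assoc)
qed

lemma int_pow_numeral_2: "g \<in> carrier G \<Longrightarrow> g [^] (2 :: int) = g \<otimes> g"
  using int_pow_mult[of g 1 1] by simp

end

lemma bass_serre_hom:
  assumes "group Q" and rel: "amalgam_relations Q a b c t s"
  obtains \<phi> where "\<phi> \<in> hom bass_serre_group Q"
    "\<And>m n. \<phi> (vertex_elem 0 (m, n)) = a [^]\<^bsub>Q\<^esub> m \<otimes>\<^bsub>Q\<^esub> t [^]\<^bsub>Q\<^esub> n"
    "\<And>m n. \<phi> (vertex_elem 1 (m, n)) = a [^]\<^bsub>Q\<^esub> m \<otimes>\<^bsub>Q\<^esub> s [^]\<^bsub>Q\<^esub> n"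
    "\<phi> (edge_elem 0) = b" "\<phi> (edge_elem 1) = c" "\<phi> (edge_elem 2) = \<one>\<^bsub>Q\<^esub>"
proof -
  interpret Q: group Q by fact
  note cl = amalgam_relations_closed[OF rel]
  have ta: "t \<otimes>\<^bsub>Q\<^esub> a = a \<otimes>\<^bsub>Q\<^esub> t" and sa: "s \<otimes>\<^bsub>Q\<^esub> a = a \<otimes>\<^bsub>Q\<^esub> s"
    and tb: "t \<otimes>\<^bsub>Q\<^esub> b = b \<otimes>\<^bsub>Q\<^esub> a \<otimes>\<^bsub>Q\<^esub> t" and tc: "t \<otimes>\<^bsub>Q\<^esub> c = c \<otimes>\<^bsub>Q\<^esub> a \<otimes>\<^bsub>Q\<^esub> a \<otimes>\<^bsub>Q\<^esub> t"
    using rel by (simp_all add: amalgam_relations_def gersten_relations_def)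
  define vtx where "vtx v = (\<lambda>(m, n). a [^]\<^bsub>Q\<^esub> (m :: int) \<otimes>\<^bsub>Q\<^esub> (if v = 0 then t else s) [^]\<^bsub>Q\<^esub> (n :: int))" for v :: nat
  define edge where "edge e = (if e = 0 then b else if e = 1 then c else \<one>\<^bsub>Q\<^esub>)" for e :: nat
  define f where "f = case_sum (\<lambda>(v, p). vtx v p) edge"
  have vtx_hom: "vtx v \<in> hom plane Q" for v
    unfolding vtx_def by (rule Q.commuting_pair_hom) (use cl ta sa in auto)
  have edge_closed: "edge e \<in> carrier Q" for e by (simp add: edge_def cl)
  have vtx_closed: "vtx v p \<in> carrier Q" for v p using hom_in_carrier[OF vtx_hom] by simp
  have loop_b: "b \<otimes>\<^bsub>Q\<^esub> vtx 0 (n, n) = vtx 0 (0, n) \<otimes>\<^bsub>Q\<^esub> b" for n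
    using Q.stable_letter_relation[OF cl(1,4,2) ta, of 1 n] tb cl by (simp add: vtx_def Q.m_assoc)
  have loop_c: "c \<otimes>\<^bsub>Q\<^esub> vtx 0 (2 * n, n) = vtx 0 (0, n) \<otimes>\<^bsub>Q\<^esub> c" for n
    using Q.stable_letter_relation[OF cl(1,4,3) ta, of 2 n] tc cl
    by (simp add: vtx_def Q.m_assoc Q.int_pow_numeral_2)
  have f: "f \<in> bass_serre_letters \<rightarrow> carrier Q"
    using edge_closed vtx_closed by (auto simp: f_def bass_serre_letters_def)
  moreover have "word_value Q f u = word_value Q f v" if uv: "(u, v) \<in> bass_serre_rels" for u v
  proof -
    consider y where "(u, v) \<in> mult_relations (\<lambda>p. Inl (y, p)) plane"
      | e n where "e \<in> {0, 1, 2}" "v = [pos (Inl (0, tail_map tubular_gog e n))]"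
        "u = [pos (Inr e), pos (Inl (head tubular_graph e, head_map tubular_gog e n)), neg (Inr e)]"
      | "u = [pos (Inr 2)]" "v = []"
      using uv unfolding bass_serre_rels_def by blast
    then show ?thesis
    proof cases
      case 1
      then show ?thesis
        by (rule word_value_mult_relations[OF assms(1) vtx_hom[of y] _ group_plane, rotated]) (simp add: f_def)
    next
      case 2
      have "edge e \<otimes>\<^bsub>Q\<^esub> vtx (head tubular_graph e) (head_map tubular_gog e n)
          = vtx 0 (tail_map tubular_gog e n) \<otimes>\<^bsub>Q\<^esub> edge e"
        using 2(1) loop_b loop_c cl
        by (auto simp: edge_def tubular_gog_maps) (simp_all add: vtx_def)
      then show ?thesis
        using 2 edge_closed vtx_closed
        by (simp add: word_value_Cons f_def Q.conj_word_iff)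
    next
      case 3
      then show ?thesis by (simp add: word_value_Cons f_def edge_def)
    qed
  qed
  ultimately obtain \<phi> where \<phi>: "\<phi> \<in> hom bass_serre_group Q"
    "\<And>y. y \<in> bass_serre_letters \<Longrightarrow> \<phi> (word_class bass_serre_letters bass_serre_rels [pos y]) = f y"
    using bass_serre.hom_from_generators[OF assms(1)] by metis
  have "\<phi> (vertex_elem v p) = vtx v p" if "v \<in> {0, 1}" for v p
    using \<phi>(2)[of "Inl (v, p)"] that by (auto simp: vertex_elem_def f_def bass_serre_letters_def)
  moreover have "\<phi> (edge_elem e) = edge e" if "e \<in> {0, 1, 2}" for e
    using \<phi>(2)[of "Inr e"] that by (auto simp: edge_elem_def f_def bass_serre_letters_def)
  ultimately show thesis
    using \<phi>(1) by (intro that[of \<phi>]) (simp_all add: vtx_def edge_def)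
qed

text \<open>Hence a homomorphism on the fundamental group is determined by its values on two elements for each
  vertex and on the stable letters.\<close>

lemma vertex_elem_pow:
  assumes "v \<in> {0, 1}"
  shows "vertex_elem v (m, n) = vertex_elem v (1, 0) [^]\<^bsub>bass_serre_group\<^esub> m
    \<otimes>\<^bsub>bass_serre_group\<^esub> vertex_elem v (0, 1) [^]\<^bsub>bass_serre_group\<^esub> n"
proof -
  note hom = vertex_elem_hom[OF assms]
  have "vertex_elem v (m, n) = vertex_elem v (m, 0) \<otimes>\<^bsub>bass_serre_group\<^esub> vertex_elem v (0, n)"
    using hom_mult[OF hom, of "(m, 0)" "(0, n)"] by simp
  moreover have "vertex_elem v (m, 0) = vertex_elem v (1, 0) [^]\<^bsub>bass_serre_group\<^esub> m"
    using hom_int_pow[OF hom _ group_plane bass_serre.P.is_group, of "(1, 0)" m]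
    by (simp add: int_pow_integer_plane)
  moreover have "vertex_elem v (0, n) = vertex_elem v (0, 1) [^]\<^bsub>bass_serre_group\<^esub> n"
    using hom_int_pow[OF hom _ group_plane bass_serre.P.is_group, of "(0, 1)" n]
    by (simp add: int_pow_integer_plane)
  ultimately show ?thesis by simp
qed

text \<open>Homomorphisms in both directions exist because each group satisfies the relations of the other.
  They exchange \<open>b\<close>, \<open>c\<close> with the two stable letters and identify \<open>a, t\<close> and \<open>a, s\<close> with the standard
  generators of the vertex groups, so they are mutually inverse.\<close>

lemma bass_serre_group_iso: "bass_serre_group \<cong> gersten_amalgam"
proof -
  let ?B = bass_serre_group and ?G = gersten_amalgam
  note cl = amalgam_relations_closed[OF amalgam_relations_gens]
  obtain \<phi> where \<phi>: "\<phi> \<in> hom ?B ?G"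
    "\<And>m n. \<phi> (vertex_elem 0 (m, n)) = aA [^]\<^bsub>?G\<^esub> m \<otimes>\<^bsub>?G\<^esub> aT [^]\<^bsub>?G\<^esub> n"
    "\<And>m n. \<phi> (vertex_elem 1 (m, n)) = aA [^]\<^bsub>?G\<^esub> m \<otimes>\<^bsub>?G\<^esub> aS [^]\<^bsub>?G\<^esub> n"
    "\<phi> (edge_elem 0) = aB" "\<phi> (edge_elem 1) = aC" "\<phi> (edge_elem 2) = \<one>\<^bsub>?G\<^esub>"
    using bass_serre_hom[OF amalgam.P.is_group amalgam_relations_gens] by blast
  obtain \<psi> where \<psi>: "\<psi> \<in> hom ?G ?B" "\<psi> aA = vertex_elem 0 (1, 0)" "\<psi> aB = edge_elem 0"
    "\<psi> aC = edge_elem 1" "\<psi> aT = vertex_elem 0 (0, 1)" "\<psi> aS = vertex_elem 1 (0, 1)"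
    by (rule amalgam_hom[OF bass_serre.P.is_group amalgam_relations_bass_serre])
  interpret \<psi>: group_hom ?G ?B \<psi>
    using \<psi>(1) by (simp add: group_hom_def group_hom_axioms_def amalgam.P.is_group bass_serre.P.is_group)
  have \<phi>\<psi>: "(\<lambda>g. \<phi> (\<psi> g)) \<in> hom ?G ?G" using hom_compose[OF \<psi>(1) \<phi>(1)] by (simp add: o_def)
  have \<psi>\<phi>: "(\<lambda>g. \<psi> (\<phi> g)) \<in> hom ?B ?B" using hom_compose[OF \<phi>(1) \<psi>(1)] by (simp add: o_def)
  have id: "(\<lambda>g. g) \<in> hom G G" for G :: "('z, 'w) monoid_scheme" by (simp add: hom_def)
  show ?thesis
  proof (rule iso_by_inverse_homs[OF \<phi>(1) \<psi>(1)])
    show "\<phi> (\<psi> g) = g" if "g \<in> carrier ?G" for g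
      by (rule amalgam_hom_ext[OF amalgam.P.is_group \<phi>\<psi> id _ _ _ _ _ that])
         (simp_all add: \<phi> \<psi> cl del: One_nat_def)
    show "\<psi> (\<phi> g) = g" if "g \<in> carrier ?B" for g
    proof (rule bass_serre.hom_ext[OF bass_serre.P.is_group \<psi>\<phi> id _ that])
      have v0: "\<psi> (\<phi> (vertex_elem 0 (m, n))) = vertex_elem 0 (m, n)" for m n
        unfolding \<phi>(2) using cl by (simp add: \<psi>.hom_int_pow \<psi>(2,5) vertex_elem_pow[of 0 m n])
      have v1: "\<psi> (\<phi> (vertex_elem 1 (m, n))) = vertex_elem 1 (m, n)" for m n
        unfolding \<phi>(3) using cl
        by (simp add: \<psi>.hom_int_pow \<psi>(2,6) vertex_elem_pow[of 1 m n] vertex_elem_amalgamated del: One_nat_def)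
      have "\<psi> (\<phi> (edge_elem 2)) = edge_elem 2"
        unfolding \<phi>(6) by (simp add: edge_elem_tree)
      then have "\<psi> (\<phi> (edge_elem e)) = edge_elem e" if "e \<in> {0, 1, 2}" for e
        using that \<phi>(4,5) \<psi>(3,4) by auto
      then show "\<psi> (\<phi> (word_class bass_serre_letters bass_serre_rels [pos y]))
          = word_class bass_serre_letters bass_serre_rels [pos y]" if "y \<in> bass_serre_letters" for y
        using that v0 v1 by (auto simp: bass_serre_letters_def edge_elem_def vertex_elem_def)
    qed
  qed
qed

lemma tubular_gersten_amalgam: "tubular gersten_amalgam"
  unfolding tubular_def
proof (intro exI conjI)
  show "is_graph_of_groups tubular_gog" by (rule tubular_gog_is_graph_of_groups)
  show "fin_digraph (base tubular_gog)" "maximal_subtree tubular_tree (base tubular_gog)"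
    using wf_tubular_graph maximal_subtree_tubular by (simp_all add: tubular_gog_def)
  show "bass_serre_group \<cong> gersten_amalgam" by (rule bass_serre_group_iso)
qed (simp_all add: tubular_gog_def)

theorem theorem1p9:
  shows "torus_group \<cong> integer_group \<times>\<times> integer_group
       \<and> (\<lambda>n::int. gersten_a [^]\<^bsub>gersten_group\<^esub> n) \<in> mon integer_group gersten_group
       \<and> (\<lambda>n::int. torus_x [^]\<^bsub>torus_group\<^esub> n) \<in> mon integer_group torus_group
       \<and> tubular gersten_amalgam
       \<and> \<not> virtually_free_by_cyclic gersten_amalgam"
  using torus_group_iso_plane gersten_a_mon torus_x_mon tubular_gersten_amalgam
    gersten_amalgam_not_virtually_free_by_cyclic
  by (intro conjI)

end
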